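(* Let $\Omega$ be a domain in $\mathbb{R}^n$ $(n\ge 3)$, and set $\mathcal{T}_\Omega=\Omega\times i\,\mathbb{R}^n=\{\mathbf{x}+i\mathbf{y}:\mathbf{x}\in\Omega,\ \mathbf{y}\in\mathbb{R}^n\}\subset\mathbb{C}^n$. (i) If $\mathcal{T}_\Omega$ is Kobayashi hyperbolic, then $\Omega$ is hyperbolic. (ii) If $\mathcal{T}_\Omega$ is Kobayashi complete hyperbolic, then $\Omega$ is complete hyperbolic.
   Context: A domain is a nonempty connected open set. $\mathbb{D}=\{z=x+iy\in\mathbb{C}:|z|<1\}$. A $C^1$ map $f$ from an open subset of $\mathbb{R}^2=\mathbb{C}$ to $\mathbb{R}^n$ is conformal if $|f_x|=|f_y|$ and $f_x\cdot f_y=0$ at every point (it need not be an immersion). $\mathrm{CH}(\mathbb{D},\Omega)$ denotes the set of all conformal harmonic maps $\mathbb{D}\to\Omega$. Minimal pseudometric: for $\mathbf{x}\in\Omega$, $\mathbf{v}\in\mathbb{R}^n$, $$g_\Omega(\mathbf{x},\mathbf{v})=\inf\{1/r>0:\exists f\in \mathrm{CH}(\mathbb{D},\Omega),\ f(0)=\mathbf{x},\ f_x(0)=r\mathbf{v}\}.$$ Minimal pseudodistance: $\rho_\Omega(\mathbf{x},\mathbf{y})=\inf_\gamma\int_0^1 g_\Omega(\gamma(t),\dot\gamma(t))\,dt$, the infimum over all piecewise smooth paths $\gamma:[0,1]\to\Omega$ from $\mathbf{x}$ to $\mathbf{y}$. $\Omega$ is hyperbolic if $\rho_\Omega(\mathbf{x},\mathbf{y})>0$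 for any pair of distinct points of $\Omega$, and complete hyperbolic if moreover $(\Omega,\rho_\Omega)$ is a complete metric space. For a connected complex manifold $X$, the Kobayashi pseudometric is $\mathcal{K}_X(x,\xi)=\inf\{1/r>0:\exists f:\mathbb{D}\to X\text{ holomorphic},\ f(0)=x,\ f'(0)=r\xi\}$, and the Kobayashi pseudodistance $\mathrm{dist}_X(x,y)$ is the infimum of $\int_0^1\mathcal{K}_X(\gamma(t),\dot\gamma(t))\,dt$ over piecewise smooth paths in $X$ from $x$ to $y$. $X$ is Kobayashi hyperbolic if $\mathrm{dist}_X$ is a metric, and Kobayashi complete hyperbolic if $(X,\mathrm{dist}_X)$ is a complete metric space. *)

theory Defs
  imports "HOL-Analysis.Analysis"
begin

section \<open>Conformal harmonic maps from plane domains\<close>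

text \<open>The plane is the type \<^typ>\<open>complex\<close> with \<open>z = x + \<i> y\<close>;
  \<open>partial_x\<close> and \<open>partial_y\<close> are the real partial derivatives.\<close>

definition partial_x :: "(complex \<Rightarrow> 'a::real_normed_vector) \<Rightarrow> complex \<Rightarrow> 'a" where
  "partial_x f z = vector_derivative (\<lambda>t. f (z + of_real t)) (at 0)"

definition partial_y :: "(complex \<Rightarrow> 'a::real_normed_vector) \<Rightarrow> complex \<Rightarrow> 'a" where
  "partial_y f z = vector_derivative (\<lambda>t. f (z + \<i> * of_real t)) (at 0)"

text \<open>The set \<open>U\<close> in the following definitions is meant to be open.\<close>

definition C1_map_on :: "complex set \<Rightarrow> (complex \<Rightarrow> 'a::real_normed_vector) \<Rightarrow> bool" where
  "C1_map_on U f \<longleftrightarrow> (\<forall>z\<in>U. f differentiable (at z)) \<and>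
     continuous_on U (partial_x f) \<and> continuous_on U (partial_y f)"

definition C2_map_on :: "complex set \<Rightarrow> (complex \<Rightarrow> 'a::real_normed_vector) \<Rightarrow> bool" where
  "C2_map_on U f \<longleftrightarrow> C1_map_on U f \<and> C1_map_on U (partial_x f) \<and> C1_map_on U (partial_y f)"

definition harmonic_map_on :: "complex set \<Rightarrow> (complex \<Rightarrow> 'a::real_normed_vector) \<Rightarrow> bool" where
  "harmonic_map_on U f \<longleftrightarrow> C2_map_on U f \<and>
     (\<forall>z\<in>U. partial_x (partial_x f) z + partial_y (partial_y f) z = 0)"

text \<open>A conformal map need not be an immersion: both partial derivatives may vanish.\<close>

definition conformal_map_on :: "complex set \<Rightarrow> (complex \<Rightarrow> 'a::real_inner) \<Rightarrow> bool" where
  "conformal_map_on U f \<longleftrightarrow> C1_map_on U f \<and>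
     (\<forall>z\<in>U. norm (partial_x f z) = norm (partial_y f z) \<and> partial_x f z \<bullet> partial_y f z = 0)"

definition CH :: "(real ^ 'n) set \<Rightarrow> (complex \<Rightarrow> real ^ 'n) set" where
  "CH \<Omega> = {f. conformal_map_on (ball 0 1) f \<and> harmonic_map_on (ball 0 1) f \<and> f ` ball 0 1 \<subseteq> \<Omega>}"

section \<open>The pseudodistance induced by an infinitesimal pseudometric\<close>

text \<open>\<open>D k\<close> is the \<open>k\<close>-th derivative of \<open>\<gamma>\<close> on \<open>[a,b]\<close>, one-sided at the end points.\<close>

definition smooth_path_on :: "real \<Rightarrow> real \<Rightarrow> (real \<Rightarrow> 'a::real_normed_vector) \<Rightarrow> bool" where
  "smooth_path_on a b \<gamma> \<longleftrightarrow> (\<exists>D :: nat \<Rightarrow> real \<Rightarrow> 'a. (\<forall>t\<in>{a..b}. D 0 t = \<gamma> t) \<and>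
     (\<forall>k. \<forall>t\<in>{a..b}. (D k has_vector_derivative D (Suc k) t) (at t within {a..b})))"

text \<open>\<open>S\<close> is the set of partition points. The path is smooth on each \<^emph>\<open>closed\<close> subinterval,
  so, unlike for \<^const>\<open>valid_path\<close>, its derivative has one-sided limits at the corners.\<close>

definition piecewise_smooth_path :: "(real \<Rightarrow> 'a::real_normed_vector) \<Rightarrow> bool" where
  "piecewise_smooth_path \<gamma> \<longleftrightarrow> path \<gamma> \<and>
     (\<exists>S. finite S \<and> {0, 1} \<subseteq> S \<and> S \<subseteq> {0..1} \<and>
       (\<forall>a\<in>S. \<forall>b\<in>S. a < b \<and> {a<..<b} \<inter> S = {} \<longrightarrow> smooth_path_on a b \<gamma>))"

text \<open>Infinitesimal pseudometrics and lengths take values in \<^typ>\<open>ennreal\<close>, where the infimum of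
  the empty set is \<open>\<infinity>\<close>. The derivative of a path is only meaningful off the finitely many
  corners, which do not contribute to the integral.\<close>

definition path_length_wrt ::
    "('a \<Rightarrow> 'a \<Rightarrow> ennreal) \<Rightarrow> (real \<Rightarrow> 'a::real_normed_vector) \<Rightarrow> ennreal" where
  "path_length_wrt F \<gamma> =
     (\<integral>\<^sup>+t\<in>{0..1}. F (\<gamma> t) (vector_derivative \<gamma> (at t within {0..1})) \<partial>lborel)"

definition induced_dist ::
    "('a \<Rightarrow> 'a \<Rightarrow> ennreal) \<Rightarrow> 'a::real_normed_vector set \<Rightarrow> 'a \<Rightarrow> 'a \<Rightarrow> ennreal" where
  "induced_dist F X x y =
     (INF \<gamma>\<in>{\<gamma>. piecewise_smooth_path \<gamma> \<and> path_image \<gamma> \<subseteq> X \<and> pathstart \<gamma> = x \<and> pathfinish \<gamma> = y}.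
        path_length_wrt F \<gamma>)"

section \<open>The minimal pseudometric\<close>

definition minimal_metric :: "(real ^ 'n) set \<Rightarrow> real ^ 'n \<Rightarrow> real ^ 'n \<Rightarrow> ennreal" where
  "minimal_metric \<Omega> x v =
     Inf {ennreal (1 / r) | r. r > 0 \<and> (\<exists>f\<in>CH \<Omega>. f 0 = x \<and> partial_x f 0 = r *\<^sub>R v)}"

definition minimal_dist :: "(real ^ 'n) set \<Rightarrow> real ^ 'n \<Rightarrow> real ^ 'n \<Rightarrow> ennreal" where
  "minimal_dist \<Omega> = induced_dist (minimal_metric \<Omega>) \<Omega>"

definition hyperbolic_domain :: "(real ^ 'n) set \<Rightarrow> bool" where
  "hyperbolic_domain \<Omega> \<longleftrightarrow> (\<forall>x\<in>\<Omega>. \<forall>y\<in>\<Omega>. x \<noteq> y \<longrightarrow> minimal_dist \<Omega> x y > 0)"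

text \<open>\<^const>\<open>enn2real\<close> sends \<open>\<infinity>\<close> to \<open>0\<close>, so \<^const>\<open>Metric_space\<close> also forces
  the distance between distinct points to be finite.\<close>

definition complete_hyperbolic_domain :: "(real ^ 'n) set \<Rightarrow> bool" where
  "complete_hyperbolic_domain \<Omega> \<longleftrightarrow> hyperbolic_domain \<Omega> \<and>
     Metric_space \<Omega> (\<lambda>x y. enn2real (minimal_dist \<Omega> x y)) \<and>
     Metric_space.mcomplete \<Omega> (\<lambda>x y. enn2real (minimal_dist \<Omega> x y))"

section \<open>The Kobayashi pseudometric of a domain in \<open>\<complex>\<^sup>n\<close>\<close>

text \<open>A map into \<open>\<complex>\<^sup>n\<close> is holomorphic iff all its components are.\<close>

definition holomorphic_discs :: "(complex ^ 'n) set \<Rightarrow> (complex \<Rightarrow> complex ^ 'n) set" where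
  "holomorphic_discs X = {f. (\<forall>i. (\<lambda>z. f z $ i) holomorphic_on ball 0 1) \<and> f ` ball 0 1 \<subseteq> X}"

definition kobayashi_metric ::
    "(complex ^ 'n) set \<Rightarrow> complex ^ 'n \<Rightarrow> complex ^ 'n \<Rightarrow> ennreal" where
  "kobayashi_metric X x \<xi> =
     Inf {ennreal (1 / r) | r. r > 0 \<and>
       (\<exists>f\<in>holomorphic_discs X. f 0 = x \<and> (\<chi> i. deriv (\<lambda>z. f z $ i) 0) = r *\<^sub>R \<xi>)}"

definition kobayashi_dist ::
    "(complex ^ 'n) set \<Rightarrow> complex ^ 'n \<Rightarrow> complex ^ 'n \<Rightarrow> ennreal" where
  "kobayashi_dist X = induced_dist (kobayashi_metric X) X"

definition kobayashi_hyperbolic :: "(complex ^ 'n) set \<Rightarrow> bool" where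
  "kobayashi_hyperbolic X \<longleftrightarrow> Metric_space X (\<lambda>x y. enn2real (kobayashi_dist X x y))"

definition kobayashi_complete_hyperbolic :: "(complex ^ 'n) set \<Rightarrow> bool" where
  "kobayashi_complete_hyperbolic X \<longleftrightarrow>
     Metric_space X (\<lambda>x y. enn2real (kobayashi_dist X x y)) \<and>
     Metric_space.mcomplete X (\<lambda>x y. enn2real (kobayashi_dist X x y))"

section \<open>Tube domains\<close>

definition tube :: "(real ^ 'n) set \<Rightarrow> (complex ^ 'n) set" where
  "tube \<Omega> = {(\<chi> i. complex_of_real (x $ i) + \<i> * complex_of_real (y $ i)) | x y. x \<in> \<Omega>}"

end

theory Submission
  imports Defs "HOL-Complex_Analysis.Cauchy_Integral_Formula"
begin

text \<open>
  A conformal harmonic disc \<open>f\<close> in \<open>\<Omega>\<close> is the real part of a holomorphic disc \<open>F\<close> in the tube, and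
  \<open>F\<close> may be shifted by any imaginary constant. Hence, for a fixed point \<open>z\<close> of the tube, the function
  \<open>u x = inf {dist z (x + i \<eta>)}\<close>, the infimum over all \<open>\<eta>\<close>, grows along \<open>t \<mapsto> f t\<close> at most at unit rate
  to first order. As \<open>u\<close> only depends on real parts, this bounds the forward difference quotients of
  \<open>u \<circ> \<gamma>\<close> by the minimal metric for every path \<open>\<gamma>\<close> in \<open>\<Omega>\<close>, and the reverse Fatou lemma
  integrates the bound. Thus the minimal distance from \<open>re z\<close> to \<open>y\<close> dominates the Kobayashi distance
  from \<open>z\<close> to the fibre over \<open>y\<close>, without any measurable choice of lifted paths.

  The Kobayashi distance from \<open>z\<close> is bounded below outside every Euclidean ball around \<open>z\<close>, which gives
  (i). For (ii), a fast Cauchy subsequence in \<open>\<Omega>\<close> lifts point by point to a Cauchy sequence in the tube;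
  the real part of its limit is the limit in \<open>\<Omega>\<close>, because the minimal distance is locally bounded by
  the Euclidean one.
\<close>

section \<open>Conformal harmonic discs\<close>

text \<open>If \<open>f\<close> competes for the vector \<open>v\<close>, then the derivative of its
  lift at 0 has real part \<open>r *\<^sub>R v\<close>, but its imaginary part is
  \<open>- partial_y f 0\<close>, which depends on the disc chosen. Lifting a whole path would mean
  integrating a field of such directions, with no reason for it to be measurable. Taking the infimum
  over the fibre before differentiating removes the imaginary directions: what is left is a locally
  Lipschitz real function on \<open>\<Omega>\<close>.

  A second obstacle is that the fibres are not compact, so positive distance from \<open>z\<close>
  to each point of a fibre does not by itself give a positive infimum. The lower bound comes instead
  from a small Euclidean sphere around \<open>z\<close>: it is compact and the distance from
  \<open>z\<close> is continuous and positive on it. The same bound turns Kobayashi convergence into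
  Euclidean convergence in (ii).

  Since \<open>enn2real\<close> sends infinity to 0, equalities and lower bounds for real distances
  require finiteness. On \<open>\<Omega>\<close> it comes from connectedness, on the tube from the
  metric axioms.\<close>

lemma has_derivative_partials:
  assumes "f differentiable (at z)"
  shows "(f has_derivative (\<lambda>h. Re h *\<^sub>R partial_x f z + Im h *\<^sub>R partial_y f z)) (at z)"
proof -
  obtain f' where f': "(f has_derivative f') (at z)"
    using assms by (auto simp: differentiable_def)
  interpret f': bounded_linear f' by (rule has_derivative_bounded_linear[OF f'])
  have "((\<lambda>t. f (z + c * of_real t)) has_vector_derivative f' c) (at 0)" for c :: complex
  proof -
    have "((\<lambda>t. z + c * of_real t) has_vector_derivative c) (at 0)"
      by (auto intro!: derivative_eq_intros simp: has_vector_derivative_def scaleR_conv_of_real mult.commute)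
    from vector_derivative_diff_chain_within[OF this, of f f'] f'
    show ?thesis by (auto simp: o_def intro: has_derivative_at_withinI)
  qed
  from this[of 1] this[of \<i>] have "partial_x f z = f' 1" "partial_y f z = f' \<i>"
    by (auto simp: partial_x_def partial_y_def intro!: vector_derivative_at)
  moreover have "f' h = Re h *\<^sub>R f' 1 + Im h *\<^sub>R f' \<i>" for h
  proof -
    have "f' h = f' (Re h *\<^sub>R 1 + Im h *\<^sub>R \<i>)"
      by (rule arg_cong[of _ _ f']) (simp add: complex_eq_iff)
    then show ?thesis by (simp only: f'.add f'.scaleR)
  qed
  then have "f' = (\<lambda>h. Re h *\<^sub>R f' 1 + Im h *\<^sub>R f' \<i>)" by blast
  ultimately show ?thesis using f' by simp
qed

lemma partials_eq:
  assumes "(f has_derivative (\<lambda>h. Re h *\<^sub>R a + Im h *\<^sub>R b)) (at z)"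
  shows "partial_x f z = a" "partial_y f z = b"
proof -
  have "((\<lambda>t. f (z + c * of_real t)) has_vector_derivative Re c *\<^sub>R a + Im c *\<^sub>R b) (at 0)" for c :: complex
  proof -
    have "((\<lambda>t. z + c * of_real t) has_vector_derivative c) (at 0)"
      by (auto intro!: derivative_eq_intros simp: has_vector_derivative_def scaleR_conv_of_real mult.commute)
    from vector_derivative_diff_chain_within[OF this, of f "\<lambda>h. Re h *\<^sub>R a + Im h *\<^sub>R b"] assms
    show ?thesis by (auto simp: o_def intro: has_derivative_at_withinI)
  qed
  from this[of 1] this[of \<i>] show "partial_x f z = a" "partial_y f z = b"
    by (auto simp: partial_x_def partial_y_def intro!: vector_derivative_at)
qed

text \<open>Outside \<open>U\<close> nothing is known about \<open>partial_x f\<close> and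
  \<open>partial_y f\<close>, so differentiability is proved for a representative \<open>g\<close>
  that agrees with \<open>f\<close> on \<open>U\<close> only. \<open>CH_I\<close> uses this with a
  partial derivative as \<open>f\<close> and its explicit formula as \<open>g\<close>.\<close>

lemma C1_map_onI:
  assumes U: "open U"
    and der: "\<And>z. z \<in> U \<Longrightarrow> (g has_derivative (\<lambda>h. Re h *\<^sub>R a z + Im h *\<^sub>R b z)) (at z)"
    and cont: "continuous_on U a" "continuous_on U b"
    and eq: "\<And>z. z \<in> U \<Longrightarrow> f z = g z"
  shows "C1_map_on U f" "\<And>z. z \<in> U \<Longrightarrow> partial_x f z = a z" "\<And>z. z \<in> U \<Longrightarrow> partial_y f z = b z"
proof -
  have f: "(f has_derivative (\<lambda>h. Re h *\<^sub>R a z + Im h *\<^sub>R b z)) (at z)" if "z \<in> U" for z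
    using has_derivative_transform_within_open[OF der[OF that] U that] eq by simp
  show px: "\<And>z. z \<in> U \<Longrightarrow> partial_x f z = a z" and py: "\<And>z. z \<in> U \<Longrightarrow> partial_y f z = b z"
    using partials_eq[OF f] by auto
  have "f differentiable (at z)" if "z \<in> U" for z
    using f[OF that] by (auto simp: differentiable_def)
  moreover have "continuous_on U (partial_x f) \<longleftrightarrow> continuous_on U a"
    by (rule continuous_on_cong[OF refl px])
  moreover have "continuous_on U (partial_y f) \<longleftrightarrow> continuous_on U b"
    by (rule continuous_on_cong[OF refl py])
  ultimately show "C1_map_on U f"
    unfolding C1_map_on_def using cont by blast
qed

lemma CH_I:
  fixes f :: "complex \<Rightarrow> real ^ 'n"
  assumes f: "\<And>z. z \<in> ball 0 1 \<Longrightarrow> (f has_derivative (\<lambda>h. Re h *\<^sub>R fx z + Im h *\<^sub>R fy z)) (at z)"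
    and fx: "\<And>z. z \<in> ball 0 1 \<Longrightarrow> (fx has_derivative (\<lambda>h. Re h *\<^sub>R fxx z + Im h *\<^sub>R fxy z)) (at z)"
    and fy: "\<And>z. z \<in> ball 0 1 \<Longrightarrow> (fy has_derivative (\<lambda>h. Re h *\<^sub>R fyx z + Im h *\<^sub>R fyy z)) (at z)"
    and cont: "continuous_on (ball 0 1) fxx" "continuous_on (ball 0 1) fxy"
      "continuous_on (ball 0 1) fyx" "continuous_on (ball 0 1) fyy"
    and laplace: "\<And>z. z \<in> ball 0 1 \<Longrightarrow> fxx z + fyy z = 0"
    and conf: "\<And>z. z \<in> ball 0 1 \<Longrightarrow> norm (fx z) = norm (fy z) \<and> fx z \<bullet> fy z = 0"
    and im: "f ` ball 0 1 \<subseteq> \<Omega>"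
  shows "f \<in> CH \<Omega>"
proof -
  have c: "continuous_on (ball 0 1) fx" "continuous_on (ball 0 1) fy"
    using has_derivative_continuous[OF fx] has_derivative_continuous[OF fy]
    by (simp_all add: continuous_at_imp_continuous_on)
  note 1 = C1_map_onI[where U = "ball 0 1" and f = f and g = f and a = fx and b = fy,
      OF open_ball f c refl]
  note 2 = C1_map_onI[where U = "ball 0 1" and f = "partial_x f" and g = fx and a = fxx and b = fxy,
      OF open_ball fx cont(1,2) 1(2)]
  note 3 = C1_map_onI[where U = "ball 0 1" and f = "partial_y f" and g = fy and a = fyx and b = fyy,
      OF open_ball fy cont(3,4) 1(3)]
  have "C2_map_on (ball 0 1) f"
    unfolding C2_map_on_def using 1(1) 2(1) 3(1) by blast
  then show ?thesis
    using 1(1) laplace conf im 1(2,3) 2(2) 3(3)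
    by (simp add: CH_def conformal_map_on_def harmonic_map_on_def)
qed

lemma CH_D:
  assumes "f \<in> CH \<Omega>"
  defines "fx \<equiv> partial_x f" and "fy \<equiv> partial_y f"
  shows "\<And>z. z \<in> ball 0 1 \<Longrightarrow> (f has_derivative (\<lambda>h. Re h *\<^sub>R fx z + Im h *\<^sub>R fy z)) (at z)"
    and "\<And>z. z \<in> ball 0 1 \<Longrightarrow> (fx has_derivative (\<lambda>h. Re h *\<^sub>R partial_x fx z + Im h *\<^sub>R partial_y fx z)) (at z)"
    and "\<And>z. z \<in> ball 0 1 \<Longrightarrow> (fy has_derivative (\<lambda>h. Re h *\<^sub>R partial_x fy z + Im h *\<^sub>R partial_y fy z)) (at z)"
    and "continuous_on (ball 0 1) (partial_x fx)" "continuous_on (ball 0 1) (partial_y fx)"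
      "continuous_on (ball 0 1) (partial_x fy)" "continuous_on (ball 0 1) (partial_y fy)"
    and "\<And>z. z \<in> ball 0 1 \<Longrightarrow> partial_x fx z + partial_y fy z = 0"
    and "\<And>z. z \<in> ball 0 1 \<Longrightarrow> norm (fx z) = norm (fy z) \<and> fx z \<bullet> fy z = 0"
    and "f ` ball 0 1 \<subseteq> \<Omega>"
proof -
  have "\<And>z. z \<in> ball 0 1 \<Longrightarrow> f differentiable (at z)"
    "\<And>z. z \<in> ball 0 1 \<Longrightarrow> fx differentiable (at z)"
    "\<And>z. z \<in> ball 0 1 \<Longrightarrow> fy differentiable (at z)"
    using assms(1) unfolding fx_def fy_def
    by (simp_all add: CH_def harmonic_map_on_def C2_map_on_def C1_map_on_def)
  then show "\<And>z. z \<in> ball 0 1 \<Longrightarrow> (f has_derivative (\<lambda>h. Re h *\<^sub>R fx z + Im h *\<^sub>R fy z)) (at z)"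
    and "\<And>z. z \<in> ball 0 1 \<Longrightarrow> (fx has_derivative (\<lambda>h. Re h *\<^sub>R partial_x fx z + Im h *\<^sub>R partial_y fx z)) (at z)"
    and "\<And>z. z \<in> ball 0 1 \<Longrightarrow> (fy has_derivative (\<lambda>h. Re h *\<^sub>R partial_x fy z + Im h *\<^sub>R partial_y fy z)) (at z)"
    unfolding fx_def fy_def by (simp_all only: has_derivative_partials)
qed (use assms(1) in \<open>simp_all add: CH_def conformal_map_on_def harmonic_map_on_def C2_map_on_def C1_map_on_def fx_def fy_def\<close>)

text \<open>Half a turn of the disc reverses the velocity at the centre. This makes the minimal
  metric even in the vector, hence the minimal distance symmetric.\<close>

lemma CH_uminus:
  assumes "f \<in> CH \<Omega>"
  shows "(\<lambda>z. f (- z)) \<in> CH \<Omega>" "partial_x (\<lambda>z. f (- z)) 0 = - partial_x f 0"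
proof -
  note D = CH_D[OF assms]
  have neg: "((\<lambda>z. g (- z)) has_derivative (\<lambda>h. Re h *\<^sub>R (- a (- z)) + Im h *\<^sub>R (- b (- z)))) (at z)"
    if g: "\<And>z. z \<in> ball 0 1 \<Longrightarrow> (g has_derivative (\<lambda>h. Re h *\<^sub>R a z + Im h *\<^sub>R b z)) (at z)"
      and z: "z \<in> ball 0 1"
    for g a b :: "complex \<Rightarrow> real ^ 'a" and z
  proof -
    have "(uminus has_derivative uminus) (at z)" for z :: complex
      by (auto intro!: derivative_eq_intros)
    from diff_chain_at[OF this g, of z] z show ?thesis by (simp add: o_def)
  qed
  \<comment> \<open>The first partial derivatives of the rotated disc carry a minus sign, which the
    second differentiation cancels.\<close>
  have neg': "((\<lambda>z. - g (- z)) has_derivative (\<lambda>h. Re h *\<^sub>R a (- z) + Im h *\<^sub>R b (- z))) (at z)"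
    if g: "\<And>z. z \<in> ball 0 1 \<Longrightarrow> (g has_derivative (\<lambda>h. Re h *\<^sub>R a z + Im h *\<^sub>R b z)) (at z)"
      and z: "z \<in> ball 0 1"
    for g a b :: "complex \<Rightarrow> real ^ 'a" and z
    using has_derivative_minus[OF neg[OF that]] by (simp add: add.commute)
  have c: "continuous_on (ball 0 1) (\<lambda>z. g (- z))" if "continuous_on (ball 0 1) g"
    for g :: "complex \<Rightarrow> real ^ 'a"
    by (rule continuous_on_compose2[OF that]) (auto intro!: continuous_intros)
  have f: "((\<lambda>z. f (- z)) has_derivative (\<lambda>h. Re h *\<^sub>R (- partial_x f (- z)) + Im h *\<^sub>R (- partial_y f (- z)))) (at z)"
    if "z \<in> ball 0 1" for z
    using D(1) that by (rule neg)
  show "(\<lambda>z. f (- z)) \<in> CH \<Omega>"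
  proof (rule CH_I[OF f])
    show "((\<lambda>z. - partial_x f (- z)) has_derivative (\<lambda>h. Re h *\<^sub>R partial_x (partial_x f) (- z) + Im h *\<^sub>R partial_y (partial_x f) (- z))) (at z)"
      if "z \<in> ball 0 1" for z
      using D(2) that by (rule neg')
    show "((\<lambda>z. - partial_y f (- z)) has_derivative (\<lambda>h. Re h *\<^sub>R partial_x (partial_y f) (- z) + Im h *\<^sub>R partial_y (partial_y f) (- z))) (at z)"
      if "z \<in> ball 0 1" for z
      using D(3) that by (rule neg')
    show "(\<lambda>z. f (- z)) ` ball 0 1 \<subseteq> \<Omega>"
      using D(10) by (auto simp: image_subset_iff)
  qed (use D(4-9) in \<open>auto intro: c[OF D(4)] c[OF D(5)] c[OF D(6)] c[OF D(7)]\<close>)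
  show "partial_x (\<lambda>z. f (- z)) 0 = - partial_x f 0"
    using partials_eq(1)[OF f[of 0]] by simp
qed

text \<open>Orthogonal vectors of equal length span a flat conformal disc, a similarity onto a round
  disc of radius \<open>norm v\<close>. These discs bound the minimal metric from above by a
  Euclidean ball.\<close>

lemma CH_linear:
  fixes p v w :: "real ^ 'n"
  assumes "norm v = norm w" "v \<bullet> w = 0" and ball: "ball p (norm v) \<subseteq> \<Omega>" and "v \<noteq> 0"
  defines "f \<equiv> \<lambda>z. p + Re z *\<^sub>R v + Im z *\<^sub>R w"
  shows "f \<in> CH \<Omega>" "partial_x f 0 = v"
proof -
  have f: "(f has_derivative (\<lambda>h. Re h *\<^sub>R v + Im h *\<^sub>R w)) (at z)" for z
    unfolding f_def by (auto intro!: derivative_eq_intros)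
  have *: "norm (Re z *\<^sub>R v + Im z *\<^sub>R w) = norm z * norm v" for z
  proof -
    have "(norm (Re z *\<^sub>R v + Im z *\<^sub>R w))\<^sup>2 = (Re z * norm v)\<^sup>2 + (Im z * norm w)\<^sup>2"
      using assms(2) by (simp add: power2_norm_eq_inner inner_add inner_commute[of w v] power_mult_distrib) (simp add: power2_eq_square)
    also have "\<dots> = (norm z * norm v)\<^sup>2"
      using assms(1) by (simp add: power_mult_distrib cmod_power2 algebra_simps)
    finally show ?thesis by (simp add: power2_eq_iff_nonneg)
  qed
  show "f \<in> CH \<Omega>"
  proof (rule CH_I[where fxx = "\<lambda>_. 0" and fxy = "\<lambda>_. 0" and fyx = "\<lambda>_. 0" and fyy = "\<lambda>_. 0"])
    show "f ` ball 0 1 \<subseteq> \<Omega>"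
    proof
      fix y assume "y \<in> f ` ball 0 1"
      then obtain z where z: "norm z < 1" "y = f z" by auto
      have "dist p (f z) = norm z * norm v"
        using *[of z] norm_minus_cancel[of "Re z *\<^sub>R v + Im z *\<^sub>R w"] by (simp add: f_def dist_norm add.assoc del: norm_minus_cancel)
      then have "f z \<in> ball p (norm v)" using z \<open>v \<noteq> 0\<close> by simp
      then show "y \<in> \<Omega>" using ball z by auto
    qed
  qed (use f assms(1,2) in auto)
  show "partial_x f 0 = v" using partials_eq(1)[OF f] .
qed

lemma CH_const: "p \<in> \<Omega> \<Longrightarrow> (\<lambda>_. p) \<in> CH \<Omega>" "partial_x (\<lambda>_. p) z = 0"
proof -
  show "(\<lambda>_. p) \<in> CH \<Omega>" if "p \<in> \<Omega>"
    by (rule CH_I[where fx="\<lambda>_. 0" and fy="\<lambda>_. 0" and fxx = "\<lambda>_. 0" and fxy = "\<lambda>_. 0" and fyx = "\<lambda>_. 0" and fyy = "\<lambda>_. 0"]) (use that in auto)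
  have "((\<lambda>_. p) has_derivative (\<lambda>h. Re h *\<^sub>R 0 + Im h *\<^sub>R 0)) (at z)" by simp
  from partials_eq(1)[OF this] show "partial_x (\<lambda>_. p) z = 0" .
qed

text \<open>Schwarz's theorem. The second difference of \<open>f\<close> over a square of side
  \<open>s\<close> is \<open>s * s\<close> times a value of either mixed derivative, by the mean
  value theorem applied twice in either order. Continuity lets the square shrink to
  \<open>z\<close>.\<close>

lemma mixed_partials_eq:
  fixes f :: "complex \<Rightarrow> real"
  assumes U: "open U" "z \<in> U"
    and f: "\<And>z. z \<in> U \<Longrightarrow> (f has_derivative (\<lambda>h. Re h * fx z + Im h * fy z)) (at z)"
    and fx: "\<And>z. z \<in> U \<Longrightarrow> (fx has_derivative (\<lambda>h. Re h * fxx z + Im h * fxy z)) (at z)"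
    and fy: "\<And>z. z \<in> U \<Longrightarrow> (fy has_derivative (\<lambda>h. Re h * fyx z + Im h * fyy z)) (at z)"
    and cont: "continuous_on U fxy" "continuous_on U fyx"
  shows "fxy z = fyx z"
proof -
  obtain r where r: "r > 0" "ball z r \<subseteq> U" using U by (auto simp: open_contains_ball)
  have line: "((\<lambda>t. g (a + c * of_real t)) has_real_derivative (Re c * gx (a + c * of_real t) + Im c * gy (a + c * of_real t))) (at t)"
    if "\<And>z. z \<in> U \<Longrightarrow> (g has_derivative (\<lambda>h. Re h * gx z + Im h * gy z)) (at z)" "a + c * of_real t \<in> U"
    for g gx gy :: "complex \<Rightarrow> real" and a c t
  proof -
    have "((\<lambda>t. a + c * of_real t) has_vector_derivative c) (at t)"
      by (auto intro!: derivative_eq_intros simp: has_vector_derivative_def scaleR_conv_of_real mult.commute)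
    from vector_derivative_diff_chain_within[OF this, of g] that(1)[OF that(2)]
    show ?thesis by (auto simp: o_def has_real_derivative_iff_has_vector_derivative intro: has_derivative_at_withinI)
  qed
  \<comment> \<open>Points of the square with corner \<open>z\<close> and side \<open>s\<close> are
    within \<open>2 * s\<close> of \<open>z\<close>, hence strictly within
    \<open>3 * s\<close>.\<close>
  have near: "z + of_real a + \<i> * of_real b \<in> ball z (3 * s)"
    if "0 \<le> a" "a \<le> s" "0 \<le> b" "b \<le> s" "0 < s" for a b s :: real
  proof -
    have "norm (of_real a + \<i> * of_real b) < 3 * s"
      using norm_triangle_ineq[of "of_real a" "\<i> * of_real b"] that by (simp add: norm_mult)
    moreover have "dist z (z + of_real a + \<i> * of_real b) = norm (of_real a + \<i> * of_real b)"
      by (simp only: dist_norm norm_minus_commute[of z]) (simp add: add.assoc)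
    ultimately show ?thesis by simp
  qed
  have key: "\<exists>p q. p \<in> ball z (3 * s) \<and> q \<in> ball z (3 * s) \<and> fxy p = fyx q" if s: "0 < s" "3 * s \<le> r" for s
  proof -
    have inU: "z + of_real a + \<i> * of_real b \<in> U" if "0 \<le> a" "a \<le> s" "0 \<le> b" "b \<le> s" for a b
      using near[OF that s(1)] s r by (meson subsetD subset_ball)
    \<comment> \<open>Differentiating this second difference first in the horizontal direction
      produces \<open>fxy\<close>, first in the vertical direction \<open>fyx\<close>.\<close>
    define \<Delta> where "\<Delta> = f (z + of_real s + \<i> * of_real s) - f (z + of_real s) - f (z + \<i> * of_real s) + f z"
    have "\<exists>t. 0 < t \<and> t < s \<and> f (z + of_real s + \<i> * of_real s) - f (z + of_real s) - (f (z + of_real 0 + \<i> * of_real s) - f (z + of_real 0))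
        = (s - 0) * (fx (z + of_real t + \<i> * of_real s) - fx (z + of_real t))"
    proof (rule MVT2)
      fix t assume t: "0 \<le> t" "t \<le> s"
      show "((\<lambda>t. f (z + of_real t + \<i> * of_real s) - f (z + of_real t)) has_real_derivative
          fx (z + of_real t + \<i> * of_real s) - fx (z + of_real t)) (at t)"
        using line[OF f, of "z + \<i> * of_real s" 1 t] line[OF f, of z 1 t] inU[OF t, of s] inU[OF t, of 0] s
        by (auto intro!: DERIV_diff simp: algebra_simps)
    qed (use s in auto)
    then obtain t where t: "0 < t" "t < s" "\<Delta> = s * (fx (z + of_real t + \<i> * of_real s) - fx (z + of_real t))"
      unfolding \<Delta>_def by auto
    have "\<exists>t'. 0 < t' \<and> t' < s \<and> fx (z + of_real t + \<i> * of_real s) - fx (z + of_real t + \<i> * of_real 0)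
        = (s - 0) * fxy (z + of_real t + \<i> * of_real t')"
    proof (rule MVT2)
      fix t' assume t': "0 \<le> t'" "t' \<le> s"
      show "((\<lambda>t'. fx (z + of_real t + \<i> * of_real t')) has_real_derivative fxy (z + of_real t + \<i> * of_real t')) (at t')"
        using line[OF fx, of "z + of_real t" \<i> t'] inU[OF _ _ t', of t] t by simp
    qed (use s in auto)
    then obtain t' where t': "0 < t'" "t' < s" "\<Delta> = s * (s * fxy (z + of_real t + \<i> * of_real t'))"
      using t by auto
    have "\<exists>u. 0 < u \<and> u < s \<and> f (z + of_real s + \<i> * of_real s) - f (z + \<i> * of_real s) - (f (z + of_real s + \<i> * of_real 0) - f (z + \<i> * of_real 0))
        = (s - 0) * (fy (z + of_real s + \<i> * of_real u) - fy (z + \<i> * of_real u))"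
    proof (rule MVT2)
      fix t assume t: "0 \<le> t" "t \<le> s"
      show "((\<lambda>t. f (z + of_real s + \<i> * of_real t) - f (z + \<i> * of_real t)) has_real_derivative
          fy (z + of_real s + \<i> * of_real t) - fy (z + \<i> * of_real t)) (at t)"
        using line[OF f, of "z + of_real s" \<i> t] line[OF f, of z \<i> t] inU[OF _ _ t, of s] inU[OF _ _ t, of 0] s
        by (auto intro!: DERIV_diff)
    qed (use s in auto)
    then obtain u where u: "0 < u" "u < s" "\<Delta> = s * (fy (z + of_real s + \<i> * of_real u) - fy (z + \<i> * of_real u))"
      unfolding \<Delta>_def by auto
    have "\<exists>u'. 0 < u' \<and> u' < s \<and> fy (z + of_real s + \<i> * of_real u) - fy (z + of_real 0 + \<i> * of_real u)
        = (s - 0) * fyx (z + of_real u' + \<i> * of_real u)"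
    proof (rule MVT2)
      fix t assume t: "0 \<le> t" "t \<le> s"
      show "((\<lambda>t. fy (z + of_real t + \<i> * of_real u)) has_real_derivative fyx (z + of_real t + \<i> * of_real u)) (at t)"
        using line[OF fy, of "z + \<i> * of_real u" 1 t] inU[OF t, of u] u by (simp add: algebra_simps)
    qed (use s in auto)
    then obtain u' where u': "0 < u'" "u' < s" "\<Delta> = s * (s * fyx (z + of_real u' + \<i> * of_real u))"
      using u by auto
    have "fxy (z + of_real t + \<i> * of_real t') = fyx (z + of_real u' + \<i> * of_real u)"
      using t'(3) u'(3) s(1) by simp
    moreover have "z + of_real t + \<i> * of_real t' \<in> ball z (3 * s)"
      "z + of_real u' + \<i> * of_real u \<in> ball z (3 * s)"
      using near[of t s t'] near[of u' s u] t(1,2) t'(1,2) u(1,2) u'(1,2) s(1) by auto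
    ultimately show ?thesis by blast
  qed
  have lim: "\<exists>d>0. \<forall>p. dist p z < d \<longrightarrow> dist (g p) (g z) < e" if "continuous_on U g" "e > 0"
    for g :: "complex \<Rightarrow> real" and e
    using that U by (simp add: continuous_on_eq_continuous_at continuous_at_eps_delta)
  show ?thesis
  proof (rule ccontr)
    define e where "e = dist (fxy z) (fyx z) / 2"
    assume "fxy z \<noteq> fyx z"
    then have e: "e > 0" by (simp add: e_def)
    obtain d1 d2 where "d1 > 0" "\<And>p. dist p z < d1 \<Longrightarrow> dist (fxy p) (fxy z) < e"
      and "d2 > 0" "\<And>p. dist p z < d2 \<Longrightarrow> dist (fyx p) (fyx z) < e"
      using lim[OF cont(1) e] lim[OF cont(2) e] by blast
    then obtain d where d: "d > 0"
      "\<And>p. dist p z < d \<Longrightarrow> dist (fxy p) (fxy z) < e \<and> dist (fyx p) (fyx z) < e"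
      using that[of "min d1 d2"] by simp
    obtain p q where "p \<in> ball z (min d r)" "q \<in> ball z (min d r)" "fxy p = fyx q"
      using key[of "min d r / 3"] d(1) r(1) by auto
    then have "dist (fxy p) (fxy z) < e" "dist (fxy p) (fyx z) < e"
      using d(2)[of p] d(2)[of q] by (auto simp: dist_commute)
    then show False using dist_triangle3[of "fxy z" "fyx z" "fxy p"] by (simp add: e_def)
  qed
qed

text \<open>In each component, \<open>h\<close> (f_x minus i times f_y) is the derivative of the
  function sought. Harmonicity and the symmetry of the mixed derivatives are the Cauchy-Riemann
  equations for \<open>h\<close>, and convexity of the disc supplies a primitive.\<close>

lemma CH_holomorphic_lift:
  fixes f :: "complex \<Rightarrow> real ^ 'n"
  assumes "f \<in> CH \<Omega>"
  obtains F :: "complex \<Rightarrow> complex ^ 'n"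
  where "\<And>i. (\<lambda>z. F z $ i) holomorphic_on ball 0 1"
    and "\<And>z i. z \<in> ball 0 1 \<Longrightarrow> Re (F z $ i) = f z $ i"
proof -
  note D = CH_D[OF assms]
  have "\<exists>G. G holomorphic_on ball 0 1 \<and> (\<forall>z\<in>ball 0 1. Re (G z) = f z $ i)" for i
  proof -
    define fx where "fx = (\<lambda>z. partial_x f z $ i)"
    define fy where "fy = (\<lambda>z. partial_y f z $ i)"
    define fxx where "fxx = (\<lambda>z. partial_x (partial_x f) z $ i)"
    define fxy where "fxy = (\<lambda>z. partial_y (partial_x f) z $ i)"
    define fyx where "fyx = (\<lambda>z. partial_x (partial_y f) z $ i)"
    define fyy where "fyy = (\<lambda>z. partial_y (partial_y f) z $ i)"
    have comp: "((\<lambda>z. g z $ i) has_derivative (\<lambda>h. Re h * a $ i + Im h * b $ i)) (at z)"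
      if "(g has_derivative (\<lambda>h. Re h *\<^sub>R a + Im h *\<^sub>R b)) (at z)"
      for g :: "complex \<Rightarrow> real ^ 'n" and a b z
      using bounded_linear.has_derivative[OF bounded_linear_vec_nth that, of i] by simp
    have f: "((\<lambda>z. f z $ i) has_derivative (\<lambda>h. Re h * fx z + Im h * fy z)) (at z)"
      and fx: "(fx has_derivative (\<lambda>h. Re h * fxx z + Im h * fxy z)) (at z)"
      and fy: "(fy has_derivative (\<lambda>h. Re h * fyx z + Im h * fyy z)) (at z)" if "z \<in> ball 0 1" for z
      using comp[OF D(1)[OF that]] comp[OF D(2)[OF that]] comp[OF D(3)[OF that]]
      by (simp_all add: fx_def fy_def fxx_def fxy_def fyx_def fyy_def)
    have c: "continuous_on (ball 0 1) fxy" "continuous_on (ball 0 1) fyx"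
      unfolding fxy_def fyx_def using D by (auto intro!: continuous_intros)
    have eq: "fyy z = - fxx z" "fyx z = fxy z" if "z \<in> ball 0 1" for z
      using arg_cong[OF D(8)[OF that], of "\<lambda>v. v $ i"] mixed_partials_eq[OF open_ball that f fx fy c]
      by (auto simp: fxx_def fyy_def)
    define h where "h = (\<lambda>z. complex_of_real (fx z) - \<i> * complex_of_real (fy z))"
    have h: "(h has_field_derivative complex_of_real (fxx z) - \<i> * complex_of_real (fxy z)) (at z)"
      if "z \<in> ball 0 1" for z
    proof -
      have "(h has_derivative (\<lambda>w. complex_of_real (Re w * fxx z + Im w * fxy z)
          - \<i> * complex_of_real (Re w * fyx z + Im w * fyy z))) (at z)"
        unfolding h_def
        by (intro has_derivative_diff has_derivative_mult_right has_derivative_of_real fx fy that)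
      moreover have "(\<lambda>w. complex_of_real (Re w * fxx z + Im w * fxy z)
          - \<i> * complex_of_real (Re w * fyx z + Im w * fyy z))
          = (\<lambda>w. (complex_of_real (fxx z) - \<i> * complex_of_real (fxy z)) * w)"
        by (auto simp: complex_eq_iff eq[OF that])
      ultimately show ?thesis unfolding has_field_derivative_def by simp
    qed
    have "\<exists>h'. (h has_field_derivative h') (at z)" if "z \<in> ball 0 1" for z
      using h[OF that] by blast
    then have "h holomorphic_on ball 0 1" by (simp add: holomorphic_on_open)
    then obtain G where G: "\<And>z. z \<in> ball 0 1 \<Longrightarrow> (G has_field_derivative h z) (at z within ball 0 1)"
      using holomorphic_convex_primitive'[OF convex_ball open_ball, of h 0 1] by blast
    \<comment> \<open>The real part of \<open>G\<close> has the same differential as the component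
      of \<open>f\<close>; they differ by a constant, which is then subtracted from
      \<open>G\<close>.\<close>
    have hd: "((\<lambda>z. Re (G z) - f z $ i) has_derivative (\<lambda>_. 0)) (at z within ball 0 1)" if "z \<in> ball 0 1" for z
    proof -
      have "((\<lambda>z. Re (G z)) has_derivative (\<lambda>w. Re (h z * w))) (at z within ball 0 1)"
        using G[OF that] unfolding has_field_derivative_def by (rule has_derivative_Re)
      from has_derivative_diff[OF this has_derivative_at_withinI[OF f[OF that]]]
      show ?thesis by (simp add: h_def mult.commute)
    qed
    obtain c where cc: "\<And>z. z \<in> ball 0 1 \<Longrightarrow> Re (G z) - f z $ i = c"
      using has_derivative_zero_constant[OF convex_ball hd] by blast
    have "G holomorphic_on ball 0 1"
      unfolding holomorphic_on_def field_differentiable_def using G by blast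
    then have "(\<lambda>z. G z - of_real c) holomorphic_on ball 0 1"
      by (intro holomorphic_intros)
    moreover have "Re (G z - of_real c) = f z $ i" if "z \<in> ball 0 1" for z using cc[OF that] by simp
    ultimately show ?thesis by blast
  qed
  then obtain G where "\<And>i. G i holomorphic_on ball 0 1" "\<And>i z. z \<in> ball 0 1 \<Longrightarrow> Re (G i z) = f z $ i"
    by metis
  then show ?thesis by (intro that[of "\<lambda>z. \<chi> i. G i z"]) auto
qed

section \<open>Piecewise smooth paths and their lengths\<close>

text \<open>Slope 2 serves the halves of a concatenation, slope -1 the reversed path; each
  differentiation gains one factor \<open>m\<close>. Agreement of \<open>\<gamma>'\<close> with the
  reparametrised path is demanded on the small interval only, because a concatenation follows
  another path elsewhere.\<close>

lemma smooth_path_on_affine: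
  assumes "smooth_path_on a b \<gamma>" and sub: "\<And>t. t \<in> {a'..b'} \<Longrightarrow> m * t + c \<in> {a..b}"
    and eq: "\<And>t. t \<in> {a'..b'} \<Longrightarrow> \<gamma>' t = \<gamma> (m * t + c)"
  shows "smooth_path_on a' b' \<gamma>'"
proof -
  obtain D where D0: "\<And>t. t \<in> {a..b} \<Longrightarrow> D 0 t = \<gamma> t"
    and D: "\<And>k t. t \<in> {a..b} \<Longrightarrow> (D k has_vector_derivative D (Suc k) t) (at t within {a..b})"
    using assms(1) unfolding smooth_path_on_def by blast
  have "((\<lambda>t. m ^ k *\<^sub>R D k (m * t + c)) has_vector_derivative m ^ Suc k *\<^sub>R D (Suc k) (m * t + c))
      (at t within {a'..b'})" if t: "t \<in> {a'..b'}" for k t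
  proof -
    have 1: "((\<lambda>t. m * t + c) has_vector_derivative m) (at t within {a'..b'})"
      by (auto intro!: derivative_eq_intros simp flip: has_real_derivative_iff_has_vector_derivative)
    have 2: "(D k has_vector_derivative D (Suc k) (m * t + c)) (at (m * t + c) within (\<lambda>t. m * t + c) ` {a'..b'})"
      using sub by (intro has_vector_derivative_within_subset[OF D[OF sub[OF t]]]) blast
    have "((\<lambda>t. D k (m * t + c)) has_vector_derivative m *\<^sub>R D (Suc k) (m * t + c)) (at t within {a'..b'})"
      using vector_diff_chain_within[OF 1 2] by (simp add: o_def)
    from has_vector_derivative_scaleR[OF DERIV_const[of "m ^ k"] this]
    show ?thesis by (simp add: mult.commute)
  qed
  then show ?thesis
    unfolding smooth_path_on_def
    by (intro exI[of _ "\<lambda>k t. m ^ k *\<^sub>R D k (m * t + c)"]) (simp add: D0[OF sub] eq)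
qed

text \<open>Smoothness on closed cells makes the derivative continuous up to the corners, hence
  bounded on each of the finitely many cells. This is what makes the paths Lipschitz.\<close>

lemma piecewise_smooth_path_bounded_derivative:
  fixes \<gamma> :: "real \<Rightarrow> 'a::banach"
  assumes "piecewise_smooth_path \<gamma>"
  obtains S M where "finite S" "0 \<le> M"
    "\<And>t. t \<in> {0<..<1} - S \<Longrightarrow> (\<gamma> has_vector_derivative vector_derivative \<gamma> (at t)) (at t)"
    "\<And>t. t \<in> {0<..<1} - S \<Longrightarrow> norm (vector_derivative \<gamma> (at t)) \<le> M"
proof -
  obtain S where S: "finite S" "{0, 1} \<subseteq> S" "S \<subseteq> {0..1}"
    and smooth: "\<forall>a\<in>S. \<forall>b\<in>S. a < b \<and> {a<..<b} \<inter> S = {} \<longrightarrow> smooth_path_on a b \<gamma>"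
    using assms unfolding piecewise_smooth_path_def by metis
  \<comment> \<open>Nonnegativity stands outside the implication so that the bounds chosen for pairs
    that are not neighbours do no harm in the sum \<open>M\<close>.\<close>
  have "\<exists>M\<ge>0. a \<in> S \<and> b \<in> S \<and> a < b \<and> {a<..<b} \<inter> S = {} \<longrightarrow>
      (\<forall>t\<in>{a<..<b}. (\<gamma> has_vector_derivative vector_derivative \<gamma> (at t)) (at t) \<and>
        norm (vector_derivative \<gamma> (at t)) \<le> M)" for a b
  proof (cases "a \<in> S \<and> b \<in> S \<and> a < b \<and> {a<..<b} \<inter> S = {}")
    case True
    then obtain D where D0: "\<And>t. t \<in> {a..b} \<Longrightarrow> D (0::nat) t = \<gamma> t"
      and D: "\<And>k t. t \<in> {a..b} \<Longrightarrow> (D k has_vector_derivative D (Suc k) t) (at t within {a..b})"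
      using smooth unfolding smooth_path_on_def by metis
    have "continuous_on {a..b} (D 1)"
      unfolding continuous_on_eq_continuous_within using has_vector_derivative_continuous[OF D] by blast
    then have "bounded (D 1 ` {a..b})"
      by (intro compact_imp_bounded compact_continuous_image) auto
    then obtain M where M: "M > 0" "\<And>t. t \<in> {a..b} \<Longrightarrow> norm (D 1 t) \<le> M"
      by (auto simp: bounded_pos)
    have der: "(\<gamma> has_vector_derivative D 1 t) (at t)" if t: "t \<in> {a<..<b}" for t
    proof -
      have "(D 0 has_vector_derivative D 1 t) (at t)"
        using D[of t 0] t by (simp add: at_within_Icc_at)
      then show ?thesis
        by (rule has_vector_derivative_transform_within_open[where S = "{a<..<b}"]) (use t D0 in auto)
    qed
    then have "vector_derivative \<gamma> (at t) = D 1 t" if "t \<in> {a<..<b}" for t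
      using that vector_derivative_at by blast
    then show ?thesis using der M by (intro exI[of _ M]) auto
  qed auto
  then obtain B where B0: "\<And>a b. B a b \<ge> (0::real)"
    and B: "\<And>a b t. \<lbrakk>a \<in> S; b \<in> S; a < b; {a<..<b} \<inter> S = {}; t \<in> {a<..<b}\<rbrakk> \<Longrightarrow>
      (\<gamma> has_vector_derivative vector_derivative \<gamma> (at t)) (at t) \<and> norm (vector_derivative \<gamma> (at t)) \<le> B a b"
    by metis
  define M where "M = (\<Sum>a\<in>S. \<Sum>b\<in>S. B a b)"
  have M: "B a b \<le> M" if "a \<in> S" "b \<in> S" for a b
  proof -
    have "B a b \<le> (\<Sum>b\<in>S. B a b)"
      using that S B0 by (intro member_le_sum) auto
    also have "\<dots> \<le> M"
      unfolding M_def using that S B0 by (intro member_le_sum[where f = "\<lambda>a. \<Sum>b\<in>S. B a b"]) (auto intro: sum_nonneg)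
    finally show ?thesis .
  qed
  show ?thesis
  proof (rule that)
    show "finite S" "0 \<le> M" using S B0 by (auto simp: M_def intro!: sum_nonneg)
    fix t assume t: "t \<in> {0<..<1} - S"
    define a b where "a = Max {s \<in> S. s < t}" and "b = Min {s \<in> S. t < s}"
    have ne: "finite {s \<in> S. s < t}" "{s \<in> S. s < t} \<noteq> {}" "finite {s \<in> S. t < s}" "{s \<in> S. t < s} \<noteq> {}"
      using S t by auto
    have "a \<in> S" "a < t" "b \<in> S" "t < b"
      using Max_in[OF ne(1,2)] Min_in[OF ne(3,4)] by (auto simp: a_def b_def)
    moreover have "{a<..<b} \<inter> S = {}"
    proof (rule ccontr)
      assume "{a<..<b} \<inter> S \<noteq> {}"
      then obtain s where s: "s \<in> S" "a < s" "s < b" by auto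
      then consider "s < t" | "t < s" using t by (metis DiffE linorder_neqE)
      then show False
        using s Max_ge[OF ne(1), of s] Min_le[OF ne(3), of s] by cases (auto simp: a_def b_def)
    qed
    ultimately show "(\<gamma> has_vector_derivative vector_derivative \<gamma> (at t)) (at t)"
      "norm (vector_derivative \<gamma> (at t)) \<le> M"
      using B[of a b t] M[of a b] by auto
  qed
qed

lemma piecewise_smooth_path_lipschitz:
  fixes \<gamma> :: "real \<Rightarrow> 'a::banach"
  assumes "piecewise_smooth_path \<gamma>"
  obtains L where "L-lipschitz_on {0..1} \<gamma>"
proof -
  obtain S M where S: "finite S" "0 \<le> M"
    and der: "\<And>t. t \<in> {0<..<1} - S \<Longrightarrow> (\<gamma> has_vector_derivative vector_derivative \<gamma> (at t)) (at t)"
    and bound: "\<And>t. t \<in> {0<..<1} - S \<Longrightarrow> norm (vector_derivative \<gamma> (at t)) \<le> M"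
    using piecewise_smooth_path_bounded_derivative[OF assms] by blast
  have cont: "continuous_on {0..1} \<gamma>"
    using assms by (simp add: piecewise_smooth_path_def path_def)
  have *: "norm (\<gamma> b - \<gamma> a) \<le> M * (b - a)" if ab: "0 \<le> a" "a \<le> b" "b \<le> 1" for a b
  proof -
    have "((\<lambda>t. vector_derivative \<gamma> (at t)) has_integral \<gamma> b - \<gamma> a) {a..b}"
      using ab S der by (intro fundamental_theorem_of_calculus_interior_strong[of S])
        (auto intro: continuous_on_subset[OF cont])
    then have "norm (\<gamma> b - \<gamma> a) \<le> M * measure lborel (cbox a b)"
      using S bound ab by (intro has_integral_bound_spike_finite[of M "insert 0 (insert 1 S)"]) auto
    then show ?thesis using ab by simp
  qed
  have "M-lipschitz_on {0..1} \<gamma>"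
  proof (rule lipschitz_onI)
    fix s t :: real assume "s \<in> {0..1}" "t \<in> {0..1}"
    then show "dist (\<gamma> s) (\<gamma> t) \<le> M * dist s t"
      using *[of s t] *[of t s] by (cases "s \<le> t") (auto simp: dist_norm norm_minus_commute)
  qed (use S in auto)
  then show ?thesis by (rule that)
qed

section \<open>Lengths as integrals of possibly nonmeasurable functions\<close>

lemma AE_lborel_interior:
  assumes "finite S"
  shows "AE t in lborel. t \<in> {0..1} \<longrightarrow> t \<in> {0<..<1::real} - S"
proof (rule AE_I')
  show "insert 0 (insert 1 S) \<in> null_sets lborel"
    using assms by (intro finite_imp_null_set_lborel) auto
qed auto

lemma path_length_wrt_eq:
  "path_length_wrt F \<gamma> = (\<integral>\<^sup>+t\<in>{0..1}. F (\<gamma> t) (vector_derivative \<gamma> (at t)) \<partial>lborel)"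
  unfolding path_length_wrt_def
proof (rule nn_integral_cong_AE)
  show "AE t in lborel. F (\<gamma> t) (vector_derivative \<gamma> (at t within {0..1})) * indicator {0..1} t =
      F (\<gamma> t) (vector_derivative \<gamma> (at t)) * indicator {0..1} t"
    using AE_lborel_interior[OF finite.emptyI]
  proof eventually_elim
    case (elim t)
    then show ?case
      by (cases "t \<in> {0..1}") (auto simp: at_within_Icc_at)
  qed
qed

text \<open>No measurability is assumed below: the integral is a supremum over simple functions.\<close>

lemma nn_integral_affine_le:
  fixes f g :: "real \<Rightarrow> ennreal"
  assumes c: "c \<noteq> 0" and le: "AE x in lborel. ennreal \<bar>c\<bar> * f (t + c * x) \<le> g x"
  shows "(\<integral>\<^sup>+x. f x \<partial>lborel) \<le> (\<integral>\<^sup>+x. g x \<partial>lborel)"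
  unfolding nn_integral_def[of lborel f]
proof (rule SUP_least)
  fix s assume "s \<in> {s. simple_function lborel s \<and> s \<le> f}"
  then have s: "simple_function lborel s" "s \<le> f" by auto
  have [measurable]: "s \<in> borel_measurable borel"
    using borel_measurable_simple_function[OF s(1)] by simp
  have "integral\<^sup>S lborel s = (\<integral>\<^sup>+x. s x \<partial>lborel)"
    by (rule nn_integral_eq_simple_integral[OF s(1), symmetric])
  also have "\<dots> = \<bar>c\<bar> * (\<integral>\<^sup>+x. s (t + c * x) \<partial>lborel)"
    by (rule nn_integral_real_affine[OF _ c]) simp
  also have "\<dots> = (\<integral>\<^sup>+x. \<bar>c\<bar> * s (t + c * x) \<partial>lborel)"
    by (rule nn_integral_cmult[symmetric]) simp
  also have "\<dots> \<le> (\<integral>\<^sup>+x. g x \<partial>lborel)"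
  proof (rule nn_integral_mono_AE)
    show "AE x in lborel. ennreal \<bar>c\<bar> * s (t + c * x) \<le> g x"
      using le
    proof eventually_elim
      case (elim x)
      have "ennreal \<bar>c\<bar> * s (t + c * x) \<le> ennreal \<bar>c\<bar> * f (t + c * x)"
        using s(2) by (intro mult_left_mono) (auto simp: le_fun_def)
      then show ?case using elim by (rule order_trans)
    qed
  qed
  finally show "integral\<^sup>S lborel s \<le> (\<integral>\<^sup>+x. g x \<partial>lborel)" .
qed

text \<open>A simple minorant of \<open>f\<close> splits along the measurable set \<open>A\<close>
  even when \<open>f\<close> is not measurable. This separates the two halves of a concatenated
  path.\<close>

lemma nn_integral_split_le:
  fixes f :: "real \<Rightarrow> ennreal"
  assumes A: "A \<in> sets borel"
  shows "(\<integral>\<^sup>+x. f x \<partial>lborel) \<le> (\<integral>\<^sup>+x\<in>A. f x \<partial>lborel) + (\<integral>\<^sup>+x\<in>-A. f x \<partial>lborel)"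
  unfolding nn_integral_def[of lborel f]
proof (rule SUP_least)
  note A[measurable]
  fix s assume "s \<in> {s. simple_function lborel s \<and> s \<le> f}"
  then have s: "simple_function lborel s" "s \<le> f" by auto
  have [measurable]: "s \<in> borel_measurable borel"
    using borel_measurable_simple_function[OF s(1)] by simp
  have "integral\<^sup>S lborel s = (\<integral>\<^sup>+x. s x \<partial>lborel)"
    by (rule nn_integral_eq_simple_integral[OF s(1), symmetric])
  also have "\<dots> = (\<integral>\<^sup>+x. s x * indicator A x + s x * indicator (-A) x \<partial>lborel)"
    by (rule nn_integral_cong) (simp split: split_indicator)
  also have "\<dots> = (\<integral>\<^sup>+x\<in>A. s x \<partial>lborel) + (\<integral>\<^sup>+x\<in>-A. s x \<partial>lborel)"
    by (rule nn_integral_add) auto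
  also have "\<dots> \<le> (\<integral>\<^sup>+x\<in>A. f x \<partial>lborel) + (\<integral>\<^sup>+x\<in>-A. f x \<partial>lborel)"
    using s(2) by (intro add_mono nn_integral_mono mult_right_mono) (auto simp: le_fun_def)
  finally show "integral\<^sup>S lborel s \<le> \<dots>" .
qed

section \<open>Concatenation, reversal and segments\<close>

lemma piecewise_smooth_path_join:
  assumes "piecewise_smooth_path \<gamma>1" "piecewise_smooth_path \<gamma>2" and fs: "pathfinish \<gamma>1 = pathstart \<gamma>2"
  shows "piecewise_smooth_path (\<gamma>1 +++ \<gamma>2)"
proof -
  obtain S1 where S1: "finite S1" "{0, 1} \<subseteq> S1" "S1 \<subseteq> {0..1}"
    and smooth1: "\<forall>a\<in>S1. \<forall>b\<in>S1. a < b \<and> {a<..<b} \<inter> S1 = {} \<longrightarrow> smooth_path_on a b \<gamma>1"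
    using assms(1) unfolding piecewise_smooth_path_def by metis
  obtain S2 where S2: "finite S2" "{0, 1} \<subseteq> S2" "S2 \<subseteq> {0..1}"
    and smooth2: "\<forall>a\<in>S2. \<forall>b\<in>S2. a < b \<and> {a<..<b} \<inter> S2 = {} \<longrightarrow> smooth_path_on a b \<gamma>2"
    using assms(2) unfolding piecewise_smooth_path_def by metis
  define S where "S = (\<lambda>s. s / 2) ` S1 \<union> (\<lambda>s. (s + 1) / 2) ` S2"
  have mem1: "2 * s \<in> S1" if "s \<in> S" "s \<le> 1 / 2" for s
    using that S1(2) S2(3) by (force simp: S_def)
  have mem2: "2 * s - 1 \<in> S2" if s: "s \<in> S" "s \<ge> 1 / 2" for s
  proof -
    consider r where "r \<in> S1" "s = r / 2" | r where "r \<in> S2" "s = (r + 1) / 2"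
      using s(1) unfolding S_def by blast
    then show ?thesis
    proof cases
      case 1
      \<comment> \<open>The joint is the only point of the first half with
        \<open>s \<ge> 1 / 2\<close>; it corresponds to the start of
        \<open>\<gamma>2\<close>.\<close>
      then have "r = 1" using s(2) S1(3) by auto
      then have "2 * s - 1 = 0" using 1 by simp
      then show ?thesis using S2(2) by simp
    qed (simp add: field_simps)
  qed
  have "1 \<in> S1" "0 \<in> S1" "1 \<in> S2" using S1 S2 by auto
  then have half: "1 / 2 \<in> S" and ends: "0 \<in> S" "1 \<in> S" by (force simp: S_def)+
  have "smooth_path_on a b (\<gamma>1 +++ \<gamma>2)" if ab: "a \<in> S" "b \<in> S" "a < b" "{a<..<b} \<inter> S = {}" for a b
  proof -
    \<comment> \<open>As 1/2 is a partition point, no cell straddles the joint.\<close>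
    have "b \<le> 1 / 2 \<or> a \<ge> 1 / 2"
      using half ab(4) by (meson disjoint_iff greaterThanLessThan_iff not_le)
    then show ?thesis
    proof
      assume b: "b \<le> 1 / 2"
      have "{2 * a<..<2 * b} \<inter> S1 = {}"
      proof (rule ccontr)
        assume "{2 * a<..<2 * b} \<inter> S1 \<noteq> {}"
        then obtain s where "s \<in> S1" "2 * a < s" "s < 2 * b" by auto
        then have "s / 2 \<in> {a<..<b} \<inter> S" by (auto simp: S_def)
        then show False using ab by blast
      qed
      then have "smooth_path_on (2 * a) (2 * b) \<gamma>1"
        using smooth1 mem1[OF ab(1)] mem1[OF ab(2)] ab b by auto
      then show ?thesis
        by (rule smooth_path_on_affine[where m = 2 and c = 0]) (use b in \<open>auto simp: joinpaths_def\<close>)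
    next
      assume a: "a \<ge> 1 / 2"
      have "{2 * a - 1<..<2 * b - 1} \<inter> S2 = {}"
      proof (rule ccontr)
        assume "{2 * a - 1<..<2 * b - 1} \<inter> S2 \<noteq> {}"
        then obtain s where "s \<in> S2" "2 * a - 1 < s" "s < 2 * b - 1" by auto
        then have "(s + 1) / 2 \<in> {a<..<b} \<inter> S" by (auto simp: S_def)
        then show False using ab by blast
      qed
      then have "smooth_path_on (2 * a - 1) (2 * b - 1) \<gamma>2"
        using smooth2 mem2[OF ab(1)] mem2[OF ab(2)] ab a by auto
      then show ?thesis
      proof (rule smooth_path_on_affine[where m = 2 and c = "-1"])
        fix t assume "t \<in> {a..b}"
        \<comment> \<open>At the joint itself \<open>+++\<close> still follows
          \<open>\<gamma>1\<close>, so agreement with \<open>\<gamma>2\<close> there rests on the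
          matching end points.\<close>
        then have "t = 1 / 2 \<or> 1 / 2 < t" using a by auto
        then show "(\<gamma>1 +++ \<gamma>2) t = \<gamma>2 (2 * t + - 1)"
        proof
          assume "t = 1 / 2"
          then have "2 * t = 1" "2 * t + - 1 = 0" "t \<le> 1 / 2" by simp_all
          then show ?thesis
            using fs by (simp only: joinpaths_def pathfinish_def pathstart_def if_True)
        qed (simp add: joinpaths_def)
      qed auto
    qed
  qed
  moreover have "finite S" "S \<subseteq> {0..1}"
    using S1 S2 by (auto simp: S_def)
  moreover have "path (\<gamma>1 +++ \<gamma>2)"
    using assms by (auto simp: piecewise_smooth_path_def)
  ultimately show ?thesis
    unfolding piecewise_smooth_path_def using ends by blast
qed

lemma piecewise_smooth_path_reverse:
  assumes "piecewise_smooth_path \<gamma>"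
  shows "piecewise_smooth_path (reversepath \<gamma>)"
proof -
  obtain S where S: "finite S" "{0, 1} \<subseteq> S" "S \<subseteq> {0..1}"
    and smooth: "\<forall>a\<in>S. \<forall>b\<in>S. a < b \<and> {a<..<b} \<inter> S = {} \<longrightarrow> smooth_path_on a b \<gamma>"
    using assms unfolding piecewise_smooth_path_def by metis
  define T where "T = (\<lambda>s. 1 - s) ` S"
  have mem: "1 - s \<in> S" if "s \<in> T" for s using that by (auto simp: T_def)
  have "smooth_path_on a b (reversepath \<gamma>)" if ab: "a \<in> T" "b \<in> T" "a < b" "{a<..<b} \<inter> T = {}" for a b
  proof -
    have "{1 - b<..<1 - a} \<inter> S = {}"
    proof (rule ccontr)
      assume "{1 - b<..<1 - a} \<inter> S \<noteq> {}"
      then obtain s where "s \<in> S" "1 - b < s" "s < 1 - a" by auto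
      then have "1 - s \<in> {a<..<b} \<inter> T" by (auto simp: T_def)
      then show False using ab by blast
    qed
    then have "smooth_path_on (1 - b) (1 - a) \<gamma>"
      using smooth mem[OF ab(1)] mem[OF ab(2)] ab by auto
    then show ?thesis
      by (rule smooth_path_on_affine[where m = "-1" and c = 1]) (auto simp: reversepath_def)
  qed
  moreover have "finite T" "T \<subseteq> {0..1}" using S by (auto simp: T_def)
  moreover have "{0, 1} \<subseteq> T" using S(2) by (force simp: T_def)
  moreover have "path (reversepath \<gamma>)"
    using assms by (auto simp: piecewise_smooth_path_def)
  ultimately show ?thesis
    unfolding piecewise_smooth_path_def by blast
qed

lemma smooth_imp_piecewise_smooth_path:
  assumes "smooth_path_on 0 1 \<gamma>"
  shows "piecewise_smooth_path \<gamma>"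
proof -
  obtain D where D0: "\<And>t. t \<in> {0..1} \<Longrightarrow> D (0::nat) t = \<gamma> t"
    and D: "\<And>k t. t \<in> {0..1} \<Longrightarrow> (D k has_vector_derivative D (Suc k) t) (at t within {0..1})"
    using assms unfolding smooth_path_on_def by metis
  have "continuous_on {0..1} (D 0)"
    unfolding continuous_on_eq_continuous_within using has_vector_derivative_continuous[OF D] by blast
  moreover have "continuous_on {0..1} (D 0) \<longleftrightarrow> continuous_on {0..1} \<gamma>"
    by (rule continuous_on_cong[OF refl D0])
  ultimately have "path \<gamma>" by (simp add: path_def)
  then show ?thesis
    unfolding piecewise_smooth_path_def using assms by (intro conjI exI[of _ "{0, 1}"]) auto
qed

lemma piecewise_smooth_path_linepath:
  "piecewise_smooth_path (linepath a b)"
proof (rule smooth_imp_piecewise_smooth_path)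
  define D where "D = (\<lambda>k::nat. if k = 0 then linepath a b else if k = 1 then (\<lambda>_. b - a) else (\<lambda>_. 0))"
  have "(D k has_vector_derivative D (Suc k) t) (at t within {0..1})" for k t
    by (auto simp: D_def has_vector_derivative_linepath_within)
  moreover have "D 0 = linepath a b" by (simp add: D_def)
  ultimately show "smooth_path_on 0 1 (linepath a b)"
    unfolding smooth_path_on_def by (metis)
qed

text \<open>Each half of the concatenation runs at double speed for half the time, so
  \<open>double\<close> compensates the factor 1/2 of the change of variables. This yields the
  triangle inequality for the induced distance.\<close>

lemma path_length_wrt_join_le:
  fixes \<gamma>1 \<gamma>2 :: "real \<Rightarrow> 'a::banach"
  assumes "piecewise_smooth_path \<gamma>1" "piecewise_smooth_path \<gamma>2"
    and double: "\<And>x v. F x (2 *\<^sub>R v) \<le> 2 * F x v"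
  shows "path_length_wrt F (\<gamma>1 +++ \<gamma>2) \<le> path_length_wrt F \<gamma>1 + path_length_wrt F \<gamma>2"
proof -
  obtain S1 where S1: "finite S1"
    and d1: "\<And>t. t \<in> {0<..<1} - S1 \<Longrightarrow> (\<gamma>1 has_vector_derivative vector_derivative \<gamma>1 (at t)) (at t)"
    using piecewise_smooth_path_bounded_derivative[OF assms(1)] by metis
  obtain S2 where S2: "finite S2"
    and d2: "\<And>t. t \<in> {0<..<1} - S2 \<Longrightarrow> (\<gamma>2 has_vector_derivative vector_derivative \<gamma>2 (at t)) (at t)"
    using piecewise_smooth_path_bounded_derivative[OF assms(2)] by metis
  let ?j = "\<gamma>1 +++ \<gamma>2"
  let ?f = "\<lambda>t. F (?j t) (vector_derivative ?j (at t)) * indicator {0..1} t"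
  have halve: "ennreal \<bar>1 / 2\<bar> * F x (2 *\<^sub>R v) \<le> F x v" for x v
  proof -
    have "ennreal (1 / 2) * F x (2 *\<^sub>R v) \<le> ennreal (1 / 2) * (2 * F x v)"
      by (rule mult_left_mono[OF double]) simp
    also have "\<dots> = ennreal (1 / 2) * ennreal 2 * F x v" by (simp add: mult.assoc)
    also have "ennreal (1 / 2) * ennreal 2 = 1" by (subst ennreal_mult[symmetric]) auto
    finally show ?thesis by simp
  qed
  have "(\<integral>\<^sup>+t. ?f t * indicator {..1 / 2} t \<partial>lborel) \<le> path_length_wrt F \<gamma>1"
    unfolding path_length_wrt_eq
  proof (rule nn_integral_affine_le[where c = "1 / 2" and t = 0])
    show "AE x in lborel. ennreal \<bar>1 / 2\<bar> * (?f (0 + 1 / 2 * x) * indicator {..1 / 2} (0 + 1 / 2 * x))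
        \<le> F (\<gamma>1 x) (vector_derivative \<gamma>1 (at x)) * indicator {0..1} x"
      using AE_lborel_interior[OF S1]
    proof eventually_elim
      case (elim x)
      show ?case
      proof (cases "x \<in> {0..1}")
        case True
        then have x: "x \<in> {0<..<1} - S1" using elim by blast
        have "((\<lambda>t. 2 * t) has_vector_derivative 2) (at (x / 2))"
          by (auto intro!: derivative_eq_intros simp flip: has_real_derivative_iff_has_vector_derivative)
        from vector_diff_chain_at[OF this, of \<gamma>1] d1[OF x]
        have "((\<lambda>t. \<gamma>1 (2 * t)) has_vector_derivative 2 *\<^sub>R vector_derivative \<gamma>1 (at x)) (at (x / 2))"
          by (simp add: o_def)
        then have "(?j has_vector_derivative 2 *\<^sub>R vector_derivative \<gamma>1 (at x)) (at (x / 2))"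
          by (rule has_vector_derivative_transform_within_open[where S = "{..<1/2}"])
            (use x in \<open>auto simp: joinpaths_def\<close>)
        then have "vector_derivative ?j (at (x / 2)) = 2 *\<^sub>R vector_derivative \<gamma>1 (at x)"
          by (rule vector_derivative_at)
        moreover have "?j (x / 2) = \<gamma>1 x" using x by (auto simp: joinpaths_def)
        ultimately show ?thesis using halve[of "\<gamma>1 x"] x by simp
      qed (auto simp: indicator_def)
    qed
  qed simp
  moreover have "(\<integral>\<^sup>+t. ?f t * indicator (- {..1 / 2}) t \<partial>lborel) \<le> path_length_wrt F \<gamma>2"
    unfolding path_length_wrt_eq
  proof (rule nn_integral_affine_le[where c = "1 / 2" and t = "1 / 2"])
    show "AE x in lborel. ennreal \<bar>1 / 2\<bar> * (?f (1 / 2 + 1 / 2 * x) * indicator (- {..1 / 2}) (1 / 2 + 1 / 2 * x))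
        \<le> F (\<gamma>2 x) (vector_derivative \<gamma>2 (at x)) * indicator {0..1} x"
      using AE_lborel_interior[OF S2]
    proof eventually_elim
      case (elim x)
      let ?y = "1 / 2 + 1 / 2 * x"
      show ?case
      proof (cases "x \<in> {0..1}")
        case True
        then have x: "x \<in> {0<..<1} - S2" using elim by blast
        have "((\<lambda>t. 2 * t - 1) has_vector_derivative 2) (at ?y)"
          by (auto intro!: derivative_eq_intros simp flip: has_real_derivative_iff_has_vector_derivative)
        from vector_diff_chain_at[OF this, of \<gamma>2] d2[OF x]
        have "((\<lambda>t. \<gamma>2 (2 * t - 1)) has_vector_derivative 2 *\<^sub>R vector_derivative \<gamma>2 (at x)) (at ?y)"
          by (simp add: o_def algebra_simps)
        then have "(?j has_vector_derivative 2 *\<^sub>R vector_derivative \<gamma>2 (at x)) (at ?y)"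
          by (rule has_vector_derivative_transform_within_open[where S = "{1/2<..}"])
            (use x in \<open>auto simp: joinpaths_def\<close>)
        then have "vector_derivative ?j (at ?y) = 2 *\<^sub>R vector_derivative \<gamma>2 (at x)"
          by (rule vector_derivative_at)
        moreover have "?j ?y = \<gamma>2 x" using x by (auto simp: joinpaths_def algebra_simps)
        ultimately show ?thesis using halve[of "\<gamma>2 x"] x by (simp add: indicator_def)
      qed (auto simp: indicator_def)
    qed
  qed simp
  moreover have "path_length_wrt F ?j \<le>
      (\<integral>\<^sup>+t. ?f t * indicator {..1 / 2} t \<partial>lborel) + (\<integral>\<^sup>+t. ?f t * indicator (- {..1 / 2}) t \<partial>lborel)"
    unfolding path_length_wrt_eq[of F ?j] by (rule nn_integral_split_le) simp
  ultimately show ?thesis by (meson add_mono order_trans)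
qed

lemma path_length_wrt_reverse_le:
  fixes \<gamma> :: "real \<Rightarrow> 'a::banach"
  assumes "piecewise_smooth_path \<gamma>" and neg: "\<And>x v. F x (- v) \<le> F x v"
  shows "path_length_wrt F (reversepath \<gamma>) \<le> path_length_wrt F \<gamma>"
proof -
  obtain S where S: "finite S"
    and d: "\<And>t. t \<in> {0<..<1} - S \<Longrightarrow> (\<gamma> has_vector_derivative vector_derivative \<gamma> (at t)) (at t)"
    using piecewise_smooth_path_bounded_derivative[OF assms(1)] by metis
  let ?r = "reversepath \<gamma>"
  show ?thesis
    unfolding path_length_wrt_eq
  proof (rule nn_integral_affine_le[where c = "-1" and t = 1])
    show "AE x in lborel. ennreal \<bar>- 1\<bar> * (F (?r (1 + - 1 * x)) (vector_derivative ?r (at (1 + - 1 * x))) *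
        indicator {0..1} (1 + - 1 * x)) \<le> F (\<gamma> x) (vector_derivative \<gamma> (at x)) * indicator {0..1} x"
      using AE_lborel_interior[OF S]
    proof eventually_elim
      case (elim x)
      show ?case
      proof (cases "x \<in> {0..1}")
        case True
        then have x: "x \<in> {0<..<1} - S" using elim by blast
        have "((\<lambda>t. 1 - t) has_vector_derivative -1) (at (1 - x))"
          by (auto intro!: derivative_eq_intros simp flip: has_real_derivative_iff_has_vector_derivative)
        from vector_diff_chain_at[OF this, of \<gamma>] d[OF x]
        have "(?r has_vector_derivative - vector_derivative \<gamma> (at x)) (at (1 - x))"
          by (simp add: o_def reversepath_def)
        then have "vector_derivative ?r (at (1 - x)) = - vector_derivative \<gamma> (at x)"
          by (rule vector_derivative_at)
        then show ?thesis using neg[of "\<gamma> x"] x by (simp add: reversepath_def)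
      qed (auto simp: indicator_def)
    qed
  qed simp
qed

lemma path_length_wrt_le_const:
  assumes "finite S" and le: "\<And>t. t \<in> {0<..<1} - S \<Longrightarrow> F (\<gamma> t) (vector_derivative \<gamma> (at t)) \<le> B"
  shows "path_length_wrt F \<gamma> \<le> B"
proof -
  have "path_length_wrt F \<gamma> \<le> (\<integral>\<^sup>+t\<in>{0..1::real}. B \<partial>lborel)"
    unfolding path_length_wrt_eq
  proof (rule nn_integral_mono_AE)
    show "AE t in lborel. F (\<gamma> t) (vector_derivative \<gamma> (at t)) * indicator {0..1} t \<le> B * indicator {0..1} t"
      using AE_lborel_interior[OF assms(1)] by eventually_elim (auto simp: indicator_def intro: le)
  qed
  then show ?thesis by (simp add: nn_integral_cmult_indicator)
qed

section \<open>The induced pseudodistance\<close>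

lemma induced_dist_le:
  assumes "piecewise_smooth_path \<gamma>" "path_image \<gamma> \<subseteq> X" "pathstart \<gamma> = x" "pathfinish \<gamma> = y"
  shows "induced_dist F X x y \<le> path_length_wrt F \<gamma>"
  unfolding induced_dist_def using assms by (intro INF_lower) auto

lemma induced_dist_lessE:
  assumes "induced_dist F X x y < c"
  obtains \<gamma> where "piecewise_smooth_path \<gamma>" "path_image \<gamma> \<subseteq> X" "pathstart \<gamma> = x" "pathfinish \<gamma> = y"
    "path_length_wrt F \<gamma> < c"
  using assms unfolding induced_dist_def by (auto simp: INF_less_iff)

lemma induced_dist_triangle:
  fixes x y z :: "'a::banach"
  assumes double: "\<And>x v. F x (2 *\<^sub>R v) \<le> 2 * F x v"
  shows "induced_dist F X x z \<le> induced_dist F X x y + induced_dist F X y z"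
proof (rule ennreal_le_epsilon)
  fix e :: real assume fin: "induced_dist F X x y + induced_dist F X y z < top" and e: "0 < e"
  have less: "d < d + ennreal (e / 2)" if "d < top" for d :: ennreal
    using that e by (cases d rule: ennreal_cases) (auto simp: ennreal_less_iff simp flip: ennreal_plus)
  obtain \<gamma>1 where 1: "piecewise_smooth_path \<gamma>1" "path_image \<gamma>1 \<subseteq> X" "pathstart \<gamma>1 = x" "pathfinish \<gamma>1 = y"
    "path_length_wrt F \<gamma>1 < induced_dist F X x y + ennreal (e / 2)"
    using induced_dist_lessE[OF less] fin by (metis ennreal_add_less_top)
  obtain \<gamma>2 where 2: "piecewise_smooth_path \<gamma>2" "path_image \<gamma>2 \<subseteq> X" "pathstart \<gamma>2 = y" "pathfinish \<gamma>2 = z"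
    "path_length_wrt F \<gamma>2 < induced_dist F X y z + ennreal (e / 2)"
    using induced_dist_lessE[OF less] fin by (metis ennreal_add_less_top)
  have "induced_dist F X x z \<le> path_length_wrt F (\<gamma>1 +++ \<gamma>2)"
    using 1 2 by (intro induced_dist_le piecewise_smooth_path_join) (auto simp: path_image_join)
  also have "\<dots> \<le> path_length_wrt F \<gamma>1 + path_length_wrt F \<gamma>2"
    using 1 2 double by (intro path_length_wrt_join_le) auto
  also have "\<dots> \<le> (induced_dist F X x y + ennreal (e / 2)) + (induced_dist F X y z + ennreal (e / 2))"
    using 1 2 by (intro add_mono) auto
  also have "\<dots> = induced_dist F X x y + induced_dist F X y z + (ennreal (e / 2) + ennreal (e / 2))"
    by (simp add: ac_simps)
  also have "ennreal (e / 2) + ennreal (e / 2) = ennreal e"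
    using e by (simp flip: ennreal_plus)
  finally show "induced_dist F X x z \<le> induced_dist F X x y + induced_dist F X y z + ennreal e" .
qed

lemma induced_dist_sym:
  fixes x y :: "'a::banach"
  assumes neg: "\<And>x v. F x (- v) \<le> F x v"
  shows "induced_dist F X x y = induced_dist F X y x"
proof -
  have "induced_dist F X x y \<le> induced_dist F X y x" for x y
  proof (rule ccontr)
    assume "\<not> induced_dist F X x y \<le> induced_dist F X y x"
    then have "induced_dist F X y x < induced_dist F X x y" by simp
    then obtain \<gamma> where \<gamma>: "piecewise_smooth_path \<gamma>" "path_image \<gamma> \<subseteq> X" "pathstart \<gamma> = y" "pathfinish \<gamma> = x"
      "path_length_wrt F \<gamma> < induced_dist F X x y"
      by (rule induced_dist_lessE)
    have "induced_dist F X x y \<le> path_length_wrt F (reversepath \<gamma>)"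
      using \<gamma> by (intro induced_dist_le piecewise_smooth_path_reverse) auto
    also have "\<dots> \<le> path_length_wrt F \<gamma>"
      using \<gamma> neg by (intro path_length_wrt_reverse_le) auto
    finally show False using \<gamma> by simp
  qed
  then show ?thesis by (intro antisym)
qed

lemma induced_dist_linepath_le:
  fixes x y :: "'a::banach"
  assumes "closed_segment x y \<subseteq> X" and "\<And>p. p \<in> closed_segment x y \<Longrightarrow> F p (y - x) \<le> B"
  shows "induced_dist F X x y \<le> B"
proof -
  have "path_length_wrt F (linepath x y) \<le> B"
    using assms by (intro path_length_wrt_le_const[of "{}"]) (auto simp: linepath_in_path)
  then show ?thesis
    using assms(1) by (intro order_trans[OF induced_dist_le]) (auto simp: piecewise_smooth_path_linepath)
qed

text \<open>The integrals of the forward difference quotients telescope to differences of means over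
  short intervals, and these converge to the increment. The Lipschitz bound then lets reverse Fatou
  move the limit inside, without any appeal to differentiability almost everywhere.\<close>

lemma nn_integral_difference_quotient_ge:
  fixes \<psi> :: "real \<Rightarrow> real"
  assumes lip: "K-lipschitz_on UNIV \<psi>"
  defines "u \<equiv> \<lambda>n t. ennreal (real (Suc n) * (\<psi> (t + inverse (real (Suc n))) - \<psi> t)) * indicator {0..1} t"
  shows "ennreal (\<psi> 1 - \<psi> 0) \<le> (\<integral>\<^sup>+t. limsup (\<lambda>n. u n t) \<partial>lborel)"
proof -
  define q where "q = (\<lambda>n t. real (Suc n) * (\<psi> (t + inverse (real (Suc n))) - \<psi> t))"
  have u: "u = (\<lambda>n t. ennreal (q n t) * indicator {0..1} t)"
    by (simp add: u_def q_def)
  have cont: "continuous_on UNIV \<psi>" using lip by (rule lipschitz_on_continuous_on)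
  have [measurable]: "\<psi> \<in> borel_measurable borel"
    using cont by (rule borel_measurable_continuous_onI)
  have qK: "q n t \<le> K" for n t
  proof -
    have "\<psi> (t + inverse (real (Suc n))) - \<psi> t \<le> dist (\<psi> (t + inverse (real (Suc n)))) (\<psi> t)"
      by (simp add: dist_real_def)
    also have "\<dots> \<le> K * dist (t + inverse (real (Suc n))) t"
      using lipschitz_onD[OF lip] by blast
    also have "\<dots> = K * inverse (real (Suc n))" by (simp add: dist_real_def)
    finally have "q n t \<le> real (Suc n) * (K * inverse (real (Suc n)))"
      unfolding q_def by (intro mult_left_mono) auto
    then show ?thesis by (simp add: divide_simps split: if_splits)
  qed
  \<comment> \<open>With the interval from -1 to 3, every \<open>t\<close> in the unit interval and
    every shifted point \<open>t + inverse (real (Suc n))\<close> is interior, so the primitive has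
    a two-sided derivative there.\<close>
  define \<Phi> where "\<Phi> = (\<lambda>t. integral {-1..t} \<psi>)"
  have \<Phi>: "(\<Phi> has_real_derivative \<psi> t) (at t)" if "t \<in> {-1<..<3}" for t
    using integral_has_real_derivative[of "-1" 3 \<psi> t] that continuous_on_subset[OF cont]
    by (simp add: \<Phi>_def at_within_Icc_at)
  \<comment> \<open>\<open>I n\<close> is the mean of \<open>\<psi>\<close> over an interval of
    length \<open>inverse (real (Suc n))\<close> starting at 1, minus the mean over the one starting
    at 0.\<close>
  define I where "I = (\<lambda>n. (\<Phi> (1 + inverse (real (Suc n))) - \<Phi> 1) * real (Suc n) - (\<Phi> (0 + inverse (real (Suc n))) - \<Phi> 0) * real (Suc n))"
  have qI: "(q n has_integral I n) {0..1}" for n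
  proof -
    have "0 < inverse (real (Suc n))" "inverse (real (Suc n)) \<le> 1" by (auto simp: field_simps)
    then have "t + inverse (real (Suc n)) \<in> {-1<..<3}" if "t \<in> {0..1}" for t
      using that unfolding atLeastAtMost_iff greaterThanLessThan_iff by linarith
    then have "((\<lambda>t. real (Suc n) * (\<Phi> (t + inverse (real (Suc n))) - \<Phi> t)) has_real_derivative q n t) (at t within {0..1})"
      if "t \<in> {0..1}" for t
      unfolding q_def using that
      by (intro DERIV_cmult DERIV_diff has_field_derivative_at_within[OF \<Phi>]
          has_field_derivative_at_within[OF DERIV_shift[THEN iffD1, OF \<Phi>]]) auto
    then have "(q n has_integral real (Suc n) * (\<Phi> (1 + inverse (real (Suc n))) - \<Phi> 1)
        - real (Suc n) * (\<Phi> (0 + inverse (real (Suc n))) - \<Phi> 0)) {0..1}"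
      by (intro fundamental_theorem_of_calculus) (auto simp: has_real_derivative_iff_has_vector_derivative)
    then show ?thesis by (simp add: I_def mult.commute)
  qed
  have "I \<longlonglongrightarrow> \<psi> 1 - \<psi> 0"
  proof -
    have "(\<lambda>n. (\<Phi> (t + inverse (real (Suc n))) - \<Phi> t) * real (Suc n)) \<longlonglongrightarrow> \<psi> t" if "t \<in> {-1<..<3}" for t
    proof -
      have "((\<lambda>h. (\<Phi> (t + h) - \<Phi> t) / h) \<longlongrightarrow> \<psi> t) (at 0)"
        using \<Phi>[OF that] by (simp add: DERIV_def)
      moreover have "filterlim (\<lambda>n. inverse (real (Suc n))) (at 0) sequentially"
        using LIMSEQ_inverse_real_of_nat by (simp add: filterlim_at)
      ultimately have "(\<lambda>n. (\<Phi> (t + inverse (real (Suc n))) - \<Phi> t) / inverse (real (Suc n))) \<longlonglongrightarrow> \<psi> t"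
        by (rule filterlim_compose)
      then show ?thesis by (simp add: field_simps)
    qed
    from tendsto_diff[OF this[of 1] this[of 0]] show ?thesis by (simp add: I_def)
  qed
  then have "(\<lambda>n. ennreal (I n)) \<longlonglongrightarrow> ennreal (\<psi> 1 - \<psi> 0)"
    by (rule tendsto_ennrealI)
  then have "ennreal (\<psi> 1 - \<psi> 0) = limsup (\<lambda>n. ennreal (I n))"
    by (intro lim_imp_Limsup[symmetric]) auto
  also have "\<dots> \<le> limsup (\<lambda>n. \<integral>\<^sup>+t. u n t \<partial>lborel)"
  proof (intro Limsup_mono always_eventually allI)
    fix n
    \<comment> \<open>In \<open>u n\<close> negative quotients are truncated to 0 by
      \<open>ennreal\<close>, so the signed integral \<open>I n\<close> is compared with the
      integral of the positive part.\<close>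
    have "(\<lambda>t. max 0 (q n t)) integrable_on {0..1}"
      unfolding q_def using continuous_on_subset[OF cont]
      by (intro integrable_continuous_interval continuous_intros continuous_on_compose2[OF cont]) auto
    then obtain J where J: "((\<lambda>t. max 0 (q n t)) has_integral J) {0..1}" by auto
    have "I n \<le> J" by (rule has_integral_le[OF qI J]) auto
    then have "ennreal (I n) \<le> ennreal J" by (rule ennreal_leI)
    also have "\<dots> = (\<integral>\<^sup>+t. ennreal (max 0 (q n t)) * indicator {0..1} t \<partial>lborel)"
      by (rule nn_integral_has_integral_lebesgue'[OF _ J, symmetric]) auto
    also have "\<dots> = (\<integral>\<^sup>+t. u n t \<partial>lborel)"
      by (rule nn_integral_cong) (auto simp: u max_def ennreal_neg)
    finally show "ennreal (I n) \<le> (\<integral>\<^sup>+t. u n t \<partial>lborel)" .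
  qed
  \<comment> \<open>Reverse Fatou, with the constant \<open>K\<close> on the unit interval as
    integrable majorant.\<close>
  also have "\<dots> \<le> (\<integral>\<^sup>+t. limsup (\<lambda>n. u n t) \<partial>lborel)"
  proof (rule nn_integral_limsup)
    show "u n \<in> borel_measurable lborel" for n unfolding u q_def by measurable
    show "(\<lambda>t. ennreal K * indicator {0..1::real} t) \<in> borel_measurable lborel" by measurable
    show "AE t in lborel. u n t \<le> ennreal K * indicator {0..1} t" for n
      using qK[of n] by (auto simp: u indicator_def intro!: ennreal_leI)
    show "(\<integral>\<^sup>+t. ennreal K * indicator {0..1::real} t \<partial>lborel) < \<infinity>"
      by (simp add: nn_integral_cmult_indicator ennreal_mult_less_top)
  qed
  finally show ?thesis .
qed

text \<open>Lipschitz continuity of \<open>u \<circ> \<gamma>\<close> reduces the claim to a pointwise bound on forward difference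
  quotients, which only see \<open>\<gamma>\<close> to first order and can therefore be computed along \<open>\<sigma>\<close>.\<close>

lemma increment_le_path_length:
  fixes \<gamma> :: "real \<Rightarrow> 'a::banach" and u :: "'a \<Rightarrow> real"
  assumes ps: "piecewise_smooth_path \<gamma>" and im: "path_image \<gamma> \<subseteq> X"
    and lip: "\<And>x. x \<in> X \<Longrightarrow> \<exists>r>0. \<exists>C. C-lipschitz_on (ball x r \<inter> X) u"
    and disc: "\<And>x v c. \<lbrakk>x \<in> X; F x v < ennreal c; 0 < c\<rbrakk> \<Longrightarrow>
      \<exists>\<sigma>. \<sigma> 0 = x \<and> (\<sigma> has_vector_derivative v) (at 0) \<and>
        (\<forall>\<^sub>F h in at_right 0. \<sigma> h \<in> X \<and> u (\<sigma> h) \<le> u x + c * h)"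
  shows "ennreal (u (pathfinish \<gamma>) - u (pathstart \<gamma>)) \<le> path_length_wrt F \<gamma>"
proof -
  define \<phi> where "\<phi> = u \<circ> \<gamma>"
  have inX: "\<gamma> t \<in> X" if "t \<in> {0..1}" for t using im that by (auto simp: path_image_def)
  obtain L where L: "L-lipschitz_on {0..1} \<gamma>"
    using piecewise_smooth_path_lipschitz[OF ps] .
  have L0: "L \<ge> 0" by (rule lipschitz_on_nonneg[OF L])
  \<comment> \<open>\<open>local_lipschitz\<close> concerns families of functions; a one-point
    parameter set reduces it to \<open>\<phi>\<close>. Compactness of the unit interval then gives
    one global constant.\<close>
  have loc: "local_lipschitz {0::real} {0..1} (\<lambda>_. \<phi>)"
  proof (rule local_lipschitzI)
    fix s :: real assume s: "s \<in> {0..1}"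
    obtain r C where r: "r > 0" and C: "C-lipschitz_on (ball (\<gamma> s) r \<inter> X) u"
      using lip[OF inX[OF s]] by blast
    \<comment> \<open>Chosen so that \<open>L * d < r\<close>, also when
      \<open>L = 0\<close>.\<close>
    define d where "d = r / (2 * (L + 1))"
    have d: "d > 0" using r L0 by (simp add: d_def)
    have "\<gamma> ` (cball s d \<inter> {0..1}) \<subseteq> ball (\<gamma> s) r \<inter> X"
    proof safe
      fix t assume t: "t \<in> cball s d" "t \<in> {0..1}"
      have "dist (\<gamma> s) (\<gamma> t) \<le> L * dist s t" by (rule lipschitz_onD[OF L s t(2)])
      also have "\<dots> \<le> L * d" using t L0 by (intro mult_left_mono) auto
      also have "\<dots> < r"
      proof -
        have "L * r < r * (2 * (L + 1))" using r mult_nonneg_nonneg[OF L0, of r] by (simp add: algebra_simps)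
        then show ?thesis using L0 by (simp add: d_def pos_divide_less_eq)
      qed
      finally show "\<gamma> t \<in> ball (\<gamma> s) r" by simp
      show "\<gamma> t \<in> X" using inX t by blast
    qed
    then have "(C * L)-lipschitz_on (cball s d \<inter> {0..1}) \<phi>"
      unfolding \<phi>_def by (intro lipschitz_on_compose lipschitz_on_subset[OF L] lipschitz_on_subset[OF C]) auto
    then show "\<exists>d>0. \<exists>K. \<forall>t\<in>cball (t::real) d \<inter> {0}. K-lipschitz_on (cball s d \<inter> {0..1}) \<phi>" for t
      using d by blast
  qed
  obtain K where K: "K-lipschitz_on {0..1} \<phi>"
    using local_lipschitz_compact_implies_lipschitz[OF loc] by (metis compact_Icc compact_sing continuous_on_const singletonI)
  \<comment> \<open>Extending \<open>\<phi>\<close> by its end values makes difference quotients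
    meaningful at points near 1, where \<open>t + h\<close> leaves the unit interval, and keeps the
    Lipschitz constant.\<close>
  define \<psi> where "\<psi> = (\<lambda>t. \<phi> (max 0 (min 1 t)))"
  have "K-lipschitz_on UNIV \<psi>"
  proof (rule lipschitz_onI)
    fix s t :: real
    have "dist (\<psi> s) (\<psi> t) \<le> K * dist (max 0 (min 1 s)) (max 0 (min 1 t))"
      unfolding \<psi>_def by (rule lipschitz_onD[OF K]) auto
    also have "\<dots> \<le> K * dist s t"
      using lipschitz_on_nonneg[OF K] by (intro mult_left_mono) (auto simp: dist_real_def)
    finally show "dist (\<psi> s) (\<psi> t) \<le> K * dist s t" .
  qed (rule lipschitz_on_nonneg[OF K])
  note ge = nn_integral_difference_quotient_ge[OF this]
  obtain S where S: "finite S"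
    and der: "\<And>t. t \<in> {0<..<1} - S \<Longrightarrow> (\<gamma> has_vector_derivative vector_derivative \<gamma> (at t)) (at t)"
    using piecewise_smooth_path_bounded_derivative[OF ps] by metis
  let ?q = "\<lambda>n t. ennreal (real (Suc n) * (\<psi> (t + inverse (real (Suc n))) - \<psi> t))"
  have pointwise: "limsup (\<lambda>n. ?q n t) \<le> F (\<gamma> t) (vector_derivative \<gamma> (at t))" if t: "t \<in> {0<..<1} - S" for t
  proof (rule ccontr)
    let ?v = "vector_derivative \<gamma> (at t)"
    assume "\<not> limsup (\<lambda>n. ?q n t) \<le> F (\<gamma> t) ?v"
    then have "F (\<gamma> t) ?v < limsup (\<lambda>n. ?q n t)" by simp
    then obtain c' where c': "F (\<gamma> t) ?v < c'" "c' < limsup (\<lambda>n. ?q n t)" using dense by blast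
    \<comment> \<open>Two intermediate values are inserted: the comparison curve is taken for the
      smaller one, and the gap to the larger one pays for replacing \<open>\<gamma>\<close> by
      \<open>\<sigma>\<close>.\<close>
    obtain b' where b': "F (\<gamma> t) ?v < b'" "b' < c'" using dense[OF c'(1)] by blast
    obtain c where c: "c' = ennreal c" "c \<ge> 0"
      using c'(2) by (cases c' rule: ennreal_cases) auto
    obtain b where b: "b' = ennreal b" "b \<ge> 0"
      using b'(2) by (cases b' rule: ennreal_cases) auto
    have b0: "b > 0" using b b'(1) by (metis ennreal_0 less_eq_real_def not_less_zero)
    have bc: "b < c" using b'(2) b c by (simp add: ennreal_less_iff)
    have t01: "t \<in> {0..1}" using t by auto
    obtain \<sigma> where \<sigma>: "\<sigma> 0 = \<gamma> t" "(\<sigma> has_vector_derivative ?v) (at 0)"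
      "\<forall>\<^sub>F h in at_right 0. \<sigma> h \<in> X \<and> u (\<sigma> h) \<le> u (\<gamma> t) + b * h"
      using disc[OF inX[OF t01], of ?v b] b'(1) b b0 by blast
    obtain r C where r: "r > 0" and C: "C-lipschitz_on (ball (\<gamma> t) r \<inter> X) u"
      using lip[OF inX[OF t01]] by blast
    have C0: "C \<ge> 0" by (rule lipschitz_on_nonneg[OF C])
    \<comment> \<open>The curves \<open>\<sigma>\<close> and \<open>\<gamma>\<close> agree to first
      order at \<open>t\<close>, so they differ by at most \<open>\<epsilon> * h\<close>; the
      Lipschitz constant \<open>C\<close> turns this into an error below \<open>(c - b) * h\<close>.
      Adding 1 covers \<open>C = 0\<close>.\<close>
    define \<epsilon> where "\<epsilon> = (c - b) / (C + 1)"
    have \<epsilon>: "\<epsilon> > 0" "C * \<epsilon> \<le> c - b"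
      using bc C0 by (auto simp: \<epsilon>_def field_simps)
    have shift: "((\<lambda>h. \<gamma> (t + h)) has_vector_derivative ?v) (at 0)"
    proof -
      have "((\<lambda>h. t + h) has_vector_derivative 1) (at 0)"
        by (auto intro!: derivative_eq_intros simp flip: has_real_derivative_iff_has_vector_derivative)
      from vector_diff_chain_at[OF this, of \<gamma>] der[OF t] show ?thesis by (simp add: o_def)
    qed
    from has_vector_derivative_diff[OF this \<sigma>(2)]
    have "((\<lambda>h. \<gamma> (t + h) - \<sigma> h) has_derivative (\<lambda>_. 0)) (at 0)"
      by (simp add: has_vector_derivative_def)
    then obtain d where d: "d > 0" "\<And>h. norm h < d \<Longrightarrow> norm (\<gamma> (t + h) - \<sigma> h) \<le> \<epsilon> * norm h"
      using \<epsilon>(1) \<sigma>(1) unfolding has_derivative_within_alt by auto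
    have lim: "((\<lambda>h. \<gamma> (t + h)) \<longlongrightarrow> \<gamma> t) (at_right 0)" "(\<sigma> \<longlongrightarrow> \<gamma> t) (at_right 0)"
      using has_vector_derivative_continuous[OF shift] has_vector_derivative_continuous[OF \<sigma>(2)] \<sigma>(1)
      by (auto simp: continuous_within intro: filterlim_mono[OF _ order_refl at_le])
    have small: "\<forall>\<^sub>F h in at_right 0. h < min d (1 - t)"
      by (rule order_tendstoD(2)[OF tendsto_ident_at]) (use d(1) t in auto)
    have "\<forall>\<^sub>F h in at_right 0. ennreal (inverse h * (\<psi> (t + h) - \<psi> t)) \<le> ennreal c"
      using \<sigma>(3) tendstoD[OF lim(1) r] tendstoD[OF lim(2) r]
        eventually_at_right_less[of "0::real"] small
    proof eventually_elim
      case (elim h)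
      then have h: "0 < h" "h < d" "t + h < 1" using d(1) t by auto
      have "u (\<gamma> (t + h)) - u (\<sigma> h) \<le> C * dist (\<gamma> (t + h)) (\<sigma> h)"
        using lipschitz_onD[OF C, of "\<gamma> (t + h)" "\<sigma> h"] elim h t inX[of "t + h"]
        by (auto simp: dist_commute dist_real_def)
      also have "\<dots> \<le> C * (\<epsilon> * h)"
        using d(2)[of h] h C0 by (intro mult_left_mono) (auto simp: dist_norm)
      also have "\<dots> \<le> (c - b) * h"
        using mult_right_mono[OF \<epsilon>(2), of h] h by simp
      finally have "u (\<gamma> (t + h)) - u (\<gamma> t) \<le> c * h"
        using elim by (simp add: algebra_simps)
      moreover have "\<psi> (t + h) = u (\<gamma> (t + h))" "\<psi> t = u (\<gamma> t)"
        using h t by (auto simp: \<psi>_def \<phi>_def)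
      ultimately have "inverse h * (\<psi> (t + h) - \<psi> t) \<le> c"
        using h by (simp add: field_simps)
      then show ?case by (rule ennreal_leI)
    qed
    moreover have "filterlim (\<lambda>n. inverse (real (Suc n))) (at_right 0) sequentially"
      using LIMSEQ_inverse_real_of_nat by (simp add: filterlim_at)
    ultimately have "\<forall>\<^sub>F n in sequentially. ?q n t \<le> ennreal c"
      by (auto dest: eventually_compose_filterlim)
    then have "limsup (\<lambda>n. ?q n t) \<le> ennreal c" by (rule Limsup_bounded)
    then show False using c'(2) c by simp
  qed
  have "ennreal (\<psi> 1 - \<psi> 0) \<le> path_length_wrt F \<gamma>"
    unfolding path_length_wrt_eq
  proof (rule order_trans[OF ge nn_integral_mono_AE])
    show "AE t in lborel. limsup (\<lambda>n. ?q n t * indicator {0..1} t) \<le>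
        F (\<gamma> t) (vector_derivative \<gamma> (at t)) * indicator {0..1} t"
      using AE_lborel_interior[OF S]
    proof eventually_elim
      case (elim t)
      then show ?case using pointwise[of t] by (cases "t \<in> {0..1}") (auto simp: Limsup_const)
    qed
  qed
  then show ?thesis by (simp add: \<psi>_def \<phi>_def pathstart_def pathfinish_def)
qed

section \<open>Holomorphic discs and tubes\<close>

definition re_vec :: "complex ^ 'n \<Rightarrow> real ^ 'n" where
  "re_vec z = (\<chi> i. Re (z $ i))"

definition cvec :: "real ^ 'n \<Rightarrow> real ^ 'n \<Rightarrow> complex ^ 'n" where
  "cvec x y = (\<chi> i. complex_of_real (x $ i) + \<i> * complex_of_real (y $ i))"

lemma re_vec_cvec [simp]: "re_vec (cvec x y) = x"
  by (simp add: re_vec_def cvec_def vec_eq_iff)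

lemma cvec_re_vec: "cvec (re_vec z) (\<chi> i. Im (z $ i)) = z"
  by (simp add: re_vec_def cvec_def vec_eq_iff complex_eq_iff)

lemma tube_iff: "z \<in> tube \<Omega> \<longleftrightarrow> re_vec z \<in> \<Omega>"
proof
  show "z \<in> tube \<Omega> \<Longrightarrow> re_vec z \<in> \<Omega>"
    by (auto simp: tube_def re_vec_def)
  assume "re_vec z \<in> \<Omega>"
  then have "cvec (re_vec z) (\<chi> i. Im (z $ i)) \<in> tube \<Omega>"
    unfolding tube_def cvec_def by blast
  then show "z \<in> tube \<Omega>" by (simp add: cvec_re_vec)
qed

lemma norm_re_vec_diff_le: "norm (re_vec z - re_vec w) \<le> norm (z - w)"
proof -
  have "\<bar>Re (z $ i) - Re (w $ i)\<bar> \<le> norm (z $ i - w $ i)" for i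
    using abs_Re_le_cmod[of "z $ i - w $ i"] by simp
  then show ?thesis
    unfolding norm_vec_def by (intro L2_set_mono) (auto simp: re_vec_def)
qed

lemma norm_cvec_diff: "norm (cvec x y - cvec x' y) = norm (x - x')"
  unfolding norm_vec_def
proof (rule L2_set_cong[OF refl])
  fix i
  have "(cvec x y - cvec x' y) $ i = complex_of_real ((x - x') $ i)"
    by (simp add: cvec_def)
  then show "norm ((cvec x y - cvec x' y) $ i) = norm ((x - x') $ i)"
    by (simp only: norm_of_real real_norm_def)
qed

lemma norm_vec_scale:
  fixes v :: "complex ^ 'n"
  shows "norm (\<chi> i. c * v $ i) = norm c * norm v"
  by (simp add: norm_vec_def norm_mult L2_set_right_distrib)

lemma open_tube:
  assumes "open \<Omega>"
  shows "open (tube \<Omega>)"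
proof -
  have "continuous_on UNIV (re_vec :: complex ^ 'a \<Rightarrow> _)"
    unfolding re_vec_def by (intro continuous_intros)
  moreover have "tube \<Omega> = re_vec -` \<Omega>" by (auto simp: tube_iff)
  ultimately show ?thesis using assms by (simp add: open_vimage)
qed

lemma has_vector_derivative_vecI:
  fixes \<gamma> :: "real \<Rightarrow> ('a::real_normed_vector) ^ 'n"
  assumes "\<And>i. ((\<lambda>t. \<gamma> t $ i) has_vector_derivative D $ i) (at t within S)"
  shows "(\<gamma> has_vector_derivative D) (at t within S)"
  unfolding has_vector_derivative_def has_derivative_within
  using assms
  by (intro conjI bounded_linear_scaleR_left vec_tendstoI)
    (simp add: has_vector_derivative_def has_derivative_within)

section \<open>Curves in holomorphic discs\<close>

lemma holomorphic_disc_has_vector_derivative: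
  assumes "f \<in> holomorphic_discs X" and "a * t + b \<in> {-1<..<1}"
  shows "((\<lambda>t. f (complex_of_real (a * t + b))) has_vector_derivative
    a *\<^sub>R (\<chi> i. deriv (\<lambda>z. f z $ i) (complex_of_real (a * t + b)))) (at t)"
proof (rule has_vector_derivative_vecI)
  fix i
  have "(\<lambda>z. f z $ i) holomorphic_on ball 0 1"
    using assms(1) by (simp add: holomorphic_discs_def)
  then have "((\<lambda>z. f z $ i) has_field_derivative deriv (\<lambda>z. f z $ i) (complex_of_real (a * t + b)))
      (at (complex_of_real (a * t + b)))"
    using assms(2) by (intro holomorphic_derivI[of _ "ball 0 1"]) (auto simp del: of_real_add of_real_mult)
  moreover have "((\<lambda>t. complex_of_real (a * t + b)) has_vector_derivative of_real a) (at t)"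
    by (auto intro!: derivative_eq_intros)
  ultimately show "((\<lambda>t. f (complex_of_real (a * t + b)) $ i) has_vector_derivative
      (a *\<^sub>R (\<chi> i. deriv (\<lambda>z. f z $ i) (complex_of_real (a * t + b)))) $ i) (at t)"
    using field_vector_diff_chain_at[of "\<lambda>t. complex_of_real (a * t + b)" "of_real a" t "\<lambda>z. f z $ i"]
    by (simp add: o_def scaleR_conv_of_real[where 'a = complex])
qed

text \<open>As \<open>s < 1\<close>, the closed radius stays inside the open disc, so the complex
  derivatives of all orders serve as path derivatives up to both end points.\<close>

lemma smooth_path_holomorphic_disc:
  assumes f: "f \<in> holomorphic_discs X" and s: "0 \<le> s" "s < 1"
  shows "smooth_path_on 0 1 (\<lambda>t. f (complex_of_real (s * t)))"
proof -
  define D where "D = (\<lambda>k t. \<chi> i. of_real (s ^ k) * (deriv ^^ k) (\<lambda>z. f z $ i) (complex_of_real (s * t)))"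
  have "(D k has_vector_derivative D (Suc k) t) (at t within {0..1})" if t: "t \<in> {0..1}" for k t
  proof (rule has_vector_derivative_vecI)
    fix i
    have st: "s * t < 1" "0 \<le> s * t"
      using mult_right_mono[of t 1 s] s t by (auto simp: mult.commute)
    have "(\<lambda>z. f z $ i) holomorphic_on ball 0 1"
      using f by (simp add: holomorphic_discs_def)
    then have "(deriv ^^ k) (\<lambda>z. f z $ i) holomorphic_on ball 0 1"
      by (intro holomorphic_higher_deriv) auto
    then have "((deriv ^^ k) (\<lambda>z. f z $ i) has_field_derivative (deriv ^^ Suc k) (\<lambda>z. f z $ i) (complex_of_real (s * t)))
        (at (complex_of_real (s * t)))"
      using st holomorphic_derivI[of "(deriv ^^ k) (\<lambda>z. f z $ i)" "ball 0 1" "complex_of_real (s * t)"]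
      by (auto simp del: of_real_mult)
    moreover have "((\<lambda>t. complex_of_real (s * t)) has_vector_derivative of_real s) (at t)"
      by (auto intro!: derivative_eq_intros)
    ultimately have "((\<lambda>t. (deriv ^^ k) (\<lambda>z. f z $ i) (complex_of_real (s * t))) has_vector_derivative
        of_real s * (deriv ^^ Suc k) (\<lambda>z. f z $ i) (complex_of_real (s * t))) (at t)"
      using field_vector_diff_chain_at[of "\<lambda>t. complex_of_real (s * t)" "of_real s" t]
      by (simp add: o_def)
    from has_vector_derivative_mult_right[OF this, of "of_real (s ^ k)"]
    have "((\<lambda>t. D k t $ i) has_vector_derivative D (Suc k) t $ i) (at t)"
      by (simp add: D_def mult_ac)
    then show "((\<lambda>t. D k t $ i) has_vector_derivative D (Suc k) t $ i) (at t within {0..1})"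
      by (rule has_vector_derivative_at_within)
  qed
  moreover have "D 0 t = f (complex_of_real (s * t))" for t
    by (simp add: D_def vec_eq_iff)
  ultimately show ?thesis unfolding smooth_path_on_def by (intro exI[of _ D]) auto
qed

lemma kobayashi_metric_le:
  assumes "f \<in> holomorphic_discs X" "f 0 = x" "r > 0" "(\<chi> i. deriv (\<lambda>z. f z $ i) 0) = r *\<^sub>R \<xi>"
  shows "kobayashi_metric X x \<xi> \<le> ennreal (1 / r)"
  unfolding kobayashi_metric_def using assms by (intro Inf_lower) blast

text \<open>Around a point of modulus at most \<open>s\<close> a disc of radius \<open>1 - s\<close>
  still fits into the unit disc, and recentring \<open>f\<close> there by an affine map costs the
  factor \<open>1 - s\<close>. A Moebius map would be sharper, but only the first order in
  \<open>s\<close> matters later. The factor \<open>s\<close> on the vector is the speed of the path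
  used in \<open>kobayashi_dist_disc_le\<close>.\<close>

lemma kobayashi_metric_along_disc:
  assumes f: "f \<in> holomorphic_discs X" and a: "norm a \<le> s" and s: "0 < s" "s < 1"
  shows "kobayashi_metric X (f a) (s *\<^sub>R (\<chi> i. deriv (\<lambda>z. f z $ i) a)) \<le> ennreal (s / (1 - s))"
proof -
  define g where "g = (\<lambda>z. f (a + (1 - of_real s) * z))"
  have inball: "a + (1 - of_real s) * z \<in> ball 0 1" if "z \<in> ball 0 1" for z
  proof -
    have "norm ((1 - of_real s) * z) = norm (complex_of_real (1 - s)) * norm z"
      by (simp add: norm_mult)
    also have "\<dots> = (1 - s) * norm z"
      using s by (simp only: norm_of_real abs_of_nonneg)
    also have "\<dots> < 1 - s" using that s by simp
    finally have "norm (a + (1 - of_real s) * z) < 1"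
      using a norm_triangle_ineq[of a "(1 - of_real s) * z"] by simp
    then show ?thesis by simp
  qed
  have hol: "(\<lambda>z. f z $ i) holomorphic_on ball 0 1" for i
    using f by (simp add: holomorphic_discs_def)
  have "(\<lambda>z. g z $ i) holomorphic_on ball 0 1" for i
  proof -
    have "(\<lambda>z. a + (1 - of_real s) * z) holomorphic_on ball 0 1"
      by (intro holomorphic_intros)
    from holomorphic_on_compose_gen[OF this hol image_subsetI[OF inball], of i] show ?thesis
      by (simp add: g_def o_def)
  qed
  moreover have "g ` ball 0 1 \<subseteq> X"
    using f inball by (auto simp: g_def holomorphic_discs_def)
  ultimately have g: "g \<in> holomorphic_discs X"
    by (simp add: holomorphic_discs_def)
  have "deriv (\<lambda>z. g z $ i) 0 = (1 - of_real s) * deriv (\<lambda>z. f z $ i) a" for i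
  proof -
    have "((\<lambda>z. f z $ i) has_field_derivative deriv (\<lambda>z. f z $ i) a) (at (a + (1 - of_real s) * 0))"
      using a s by (auto intro!: holomorphic_derivI[OF hol])
    moreover have "((\<lambda>z. a + (1 - of_real s) * z) has_field_derivative (1 - of_real s)) (at 0)"
      by (auto intro!: derivative_eq_intros)
    ultimately have "((\<lambda>z. g z $ i) has_field_derivative deriv (\<lambda>z. f z $ i) a * (1 - of_real s)) (at 0)"
      unfolding g_def by (rule DERIV_chain2)
    then show ?thesis by (simp add: DERIV_imp_deriv mult.commute)
  qed
  then have "(\<chi> i. deriv (\<lambda>z. g z $ i) 0) = ((1 - s) / s) *\<^sub>R (s *\<^sub>R (\<chi> i. deriv (\<lambda>z. f z $ i) a))"
    using s by (simp add: vec_eq_iff scaleR_conv_of_real[where 'a = complex])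
  moreover have "g 0 = f a" by (simp add: g_def)
  ultimately have "kobayashi_metric X (f a) (s *\<^sub>R (\<chi> i. deriv (\<lambda>z. f z $ i) a)) \<le> ennreal (1 / ((1 - s) / s))"
    using s by (intro kobayashi_metric_le[OF g]) auto
  then show ?thesis by simp
qed

text \<open>Moving along a radius costs \<open>s\<close> up to second order. With
  \<open>s = h / r\<close> this becomes the rate \<open>1 / r\<close> that appears in the infimum
  defining the metric.\<close>

lemma kobayashi_dist_disc_le:
  assumes f: "f \<in> holomorphic_discs X" and s: "0 < s" "s < 1"
  shows "kobayashi_dist X (f 0) (f (of_real s)) \<le> ennreal (s / (1 - s))"
proof -
  define \<gamma> where "\<gamma> = (\<lambda>t. f (complex_of_real (s * t)))"
  have st: "0 \<le> s * t" "s * t \<le> s" if "t \<in> {0..1}" for t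
    using that s mult_left_mono[of t 1 s] by auto
  have "kobayashi_dist X (f 0) (f (of_real s)) \<le> path_length_wrt (kobayashi_metric X) \<gamma>"
    unfolding kobayashi_dist_def
  proof (rule induced_dist_le)
    show "piecewise_smooth_path \<gamma>"
      unfolding \<gamma>_def using s by (intro smooth_imp_piecewise_smooth_path smooth_path_holomorphic_disc[OF f]) auto
    show "path_image \<gamma> \<subseteq> X"
    proof
      fix y assume "y \<in> path_image \<gamma>"
      then obtain t where "t \<in> {0..1}" "y = f (complex_of_real (s * t))"
        by (auto simp: path_image_def \<gamma>_def)
      moreover from this st[of t] s(2) have "complex_of_real (s * t) \<in> ball 0 1"
        by (simp del: of_real_mult add: order_le_less_trans)
      ultimately show "y \<in> X" using f by (auto simp: holomorphic_discs_def)
    qed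
  qed (simp_all add: \<gamma>_def pathstart_def pathfinish_def)
  also have "\<dots> \<le> ennreal (s / (1 - s))"
  proof (rule path_length_wrt_le_const[OF finite.emptyI])
    fix t :: real assume t: "t \<in> {0<..<1} - {}"
    then have "0 \<le> s * t" "s * t \<le> s" using st[of t] by auto
    then have "s * t + 0 \<in> {-1<..<1}"
      using s unfolding greaterThanLessThan_iff by linarith
    from holomorphic_disc_has_vector_derivative[OF f this]
    have "vector_derivative \<gamma> (at t) = s *\<^sub>R (\<chi> i. deriv (\<lambda>z. f z $ i) (complex_of_real (s * t)))"
      unfolding \<gamma>_def by (intro vector_derivative_at) simp
    moreover have "norm (complex_of_real (s * t)) \<le> s"
      using st[of t] t by (simp del: of_real_mult)
    ultimately show "kobayashi_metric X (\<gamma> t) (vector_derivative \<gamma> (at t)) \<le> ennreal (s / (1 - s))"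
      using kobayashi_metric_along_disc[OF f _ s] by (simp add: \<gamma>_def)
  qed
  finally show ?thesis .
qed

lemma ennreal_le_inverse_real_imp_0:
  fixes a :: ennreal
  assumes "\<And>r. r > 0 \<Longrightarrow> a \<le> ennreal (1 / r)"
  shows "a = 0"
proof -
  have "a \<le> 0"
  proof (rule ennreal_le_epsilon)
    fix e :: real assume "0 < e"
    then show "a \<le> 0 + ennreal e" using assms[of "1 / e"] by simp
  qed
  then show ?thesis by simp
qed

lemma kobayashi_metric_ball_le:
  assumes ball: "ball x R \<subseteq> X" and R: "R > 0"
  shows "kobayashi_metric X x \<xi> \<le> ennreal (norm \<xi> / R)"
proof -
  define f where "f = (\<lambda>c z. x + (\<chi> i. z * (complex_of_real c * \<xi> $ i)))"
  have deriv: "(\<chi> i. deriv (\<lambda>z. f c z $ i) 0) = c *\<^sub>R \<xi>" and f0: "f c 0 = x" for c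
  proof -
    have "((\<lambda>z. f c z $ i) has_field_derivative of_real c * \<xi> $ i) (at 0)" for i
      unfolding f_def by (auto intro!: derivative_eq_intros)
    then show "(\<chi> i. deriv (\<lambda>z. f c z $ i) 0) = c *\<^sub>R \<xi>"
      by (simp add: vec_eq_iff DERIV_imp_deriv scaleR_conv_of_real[where 'a = complex])
  qed (simp add: f_def vec_eq_iff)
  have disc: "f c \<in> holomorphic_discs X" if "c > 0" "c * norm \<xi> \<le> R" for c
  proof -
    have "(\<lambda>z. f c z $ i) holomorphic_on ball 0 1" for i
      by (auto simp: f_def intro!: holomorphic_intros)
    moreover have "f c z \<in> X" if z: "norm z < 1" for z
    proof -
      have "dist x (f c z) = norm (\<chi> i. z * (\<chi> i. complex_of_real c * \<xi> $ i) $ i)"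
        by (simp add: f_def dist_norm)
      also have "\<dots> = norm z * (c * norm \<xi>)"
        unfolding norm_vec_scale using \<open>c > 0\<close> by simp
      also have "\<dots> \<le> norm z * R"
        using \<open>c * norm \<xi> \<le> R\<close> by (intro mult_left_mono) auto
      also have "\<dots> < R" using z R by simp
      finally show ?thesis using ball by auto
    qed
    ultimately show ?thesis by (auto simp: holomorphic_discs_def)
  qed
  show ?thesis
  proof (cases "\<xi> = 0")
    case True
    \<comment> \<open>For the zero vector the disc is constant and competes with every
      \<open>r\<close>, so the infimum is 0.\<close>
    have "kobayashi_metric X x \<xi> \<le> ennreal (1 / r)" if "r > 0" for r
      using kobayashi_metric_le[OF disc f0 that deriv] that True R by simp
    then have "kobayashi_metric X x \<xi> = 0" by (rule ennreal_le_inverse_real_imp_0)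
    then show ?thesis by simp
  next
    case False
    then have "kobayashi_metric X x \<xi> \<le> ennreal (1 / (R / norm \<xi>))"
      using R by (intro kobayashi_metric_le[OF disc f0 _ deriv]) auto
    then show ?thesis by simp
  qed
qed

section \<open>Scaling, local upper bounds and short segments\<close>

lemma minimal_metric_le:
  assumes "f \<in> CH \<Omega>" "f 0 = x" "r > 0" "partial_x f 0 = r *\<^sub>R v"
  shows "minimal_metric \<Omega> x v \<le> ennreal (1 / r)"
  unfolding minimal_metric_def using assms by (intro Inf_lower) blast

lemma minimal_metric_lessE:
  assumes "minimal_metric \<Omega> x v < c"
  obtains f r where "f \<in> CH \<Omega>" "f 0 = x" "r > 0" "partial_x f 0 = r *\<^sub>R v" "ennreal (1 / r) < c"
  using assms unfolding minimal_metric_def by (auto simp: Inf_less_iff)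

lemma kobayashi_metric_lessE:
  assumes "kobayashi_metric X x \<xi> < c"
  obtains f r where "f \<in> holomorphic_discs X" "f 0 = x" "r > 0"
    "(\<chi> i. deriv (\<lambda>z. f z $ i) 0) = r *\<^sub>R \<xi>" "ennreal (1 / r) < c"
  using assms unfolding kobayashi_metric_def by (auto simp: Inf_less_iff)

lemma minimal_metric_uminus_le: "minimal_metric \<Omega> x (- v) \<le> minimal_metric \<Omega> x v"
proof (rule ccontr)
  assume "\<not> ?thesis"
  then have "minimal_metric \<Omega> x v < minimal_metric \<Omega> x (- v)" by simp
  then obtain f r where f: "f \<in> CH \<Omega>" "f 0 = x" "r > 0" "partial_x f 0 = r *\<^sub>R v"
    "ennreal (1 / r) < minimal_metric \<Omega> x (- v)" by (rule minimal_metric_lessE)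
  have "minimal_metric \<Omega> x (- v) \<le> ennreal (1 / r)"
    by (rule minimal_metric_le[OF CH_uminus(1)[OF f(1)]]) (use f CH_uminus(2)[OF f(1)] in auto)
  then show False using f(5) by simp
qed

text \<open>A disc whose derivative is \<open>r\<close> times \<open>v\<close> is also one whose
  derivative is \<open>r / 2\<close> times \<open>2 *\<^sub>R v\<close>.\<close>

lemma minimal_metric_double_le: "minimal_metric \<Omega> x (2 *\<^sub>R v) \<le> 2 * minimal_metric \<Omega> x v"
proof (rule ccontr)
  have half: "ennreal (1 / 2) * (2 * a) = a" "2 * (ennreal (1 / 2) * a) = a" for a
  proof -
    have "ennreal (1 / 2) * 2 = ennreal (1 / 2) * ennreal 2" by simp
    also have "\<dots> = 1" by (subst ennreal_mult[symmetric]) auto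
    finally have *: "ennreal (1 / 2) * 2 = 1" .
    then show "ennreal (1 / 2) * (2 * a) = a" by (simp flip: mult.assoc)
    show "2 * (ennreal (1 / 2) * a) = a" using * by (simp add: mult.commute[of 2] flip: mult.assoc)
  qed
  assume "\<not> ?thesis"
  then have "\<not> ennreal (1 / 2) * minimal_metric \<Omega> x (2 *\<^sub>R v) \<le> minimal_metric \<Omega> x v"
    using mult_left_mono[OF _ zero_le,
        of "ennreal (1 / 2) * minimal_metric \<Omega> x (2 *\<^sub>R v)" "minimal_metric \<Omega> x v" 2]
    unfolding half(2) by blast
  then have "minimal_metric \<Omega> x v < ennreal (1 / 2) * minimal_metric \<Omega> x (2 *\<^sub>R v)" by simp
  then obtain f r where f: "f \<in> CH \<Omega>" "f 0 = x" "r > 0" "partial_x f 0 = r *\<^sub>R v"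
    "ennreal (1 / r) < ennreal (1 / 2) * minimal_metric \<Omega> x (2 *\<^sub>R v)" by (rule minimal_metric_lessE)
  have "minimal_metric \<Omega> x (2 *\<^sub>R v) \<le> ennreal (1 / (r / 2))"
    by (rule minimal_metric_le[OF f(1)]) (use f in auto)
  then have "ennreal (1 / 2) * minimal_metric \<Omega> x (2 *\<^sub>R v) \<le> ennreal (1 / 2) * ennreal (1 / (r / 2))"
    by (rule mult_left_mono) simp
  also have "\<dots> = ennreal (1 / r)" using f(3) by (subst ennreal_mult[symmetric]) auto
  finally show False using f(5) by simp
qed

text \<open>The dimension enters here: a conformal disc with nonzero velocity along \<open>v\<close>
  needs a second vector of the same length orthogonal to it. Scaling both to length \<open>R\<close>
  makes the flat disc fit into the ball.\<close>

lemma minimal_metric_ball_le: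
  fixes \<Omega> :: "(real ^ 'n) set"
  assumes n: "CARD('n) \<ge> 2" and ball: "ball x R \<subseteq> \<Omega>" and R: "R > 0"
  shows "minimal_metric \<Omega> x v \<le> ennreal (norm v / R)"
proof (cases "v = 0")
  case True
  have "x \<in> \<Omega>" using ball R by auto
  then have "minimal_metric \<Omega> x v \<le> ennreal (1 / r)" if "r > 0" for r
    using that True by (intro minimal_metric_le[OF CH_const(1)]) (auto simp: CH_const(2))
  then have "minimal_metric \<Omega> x v = 0" by (rule ennreal_le_inverse_real_imp_0)
  then show ?thesis by simp
next
  case False
  obtain y where y: "y \<noteq> 0" "orthogonal v y"
    using orthogonal_to_vector_exists[of v] n by auto
  define a where "a = (R / norm v) *\<^sub>R v"
  define b where "b = (R / norm y) *\<^sub>R y"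
  have "norm a = R" "norm b = R" "a \<bullet> b = 0" "a \<noteq> 0"
    using R False y by (auto simp: a_def b_def orthogonal_def)
  then have "minimal_metric \<Omega> x v \<le> ennreal (1 / (R / norm v))"
    using ball R False CH_linear[of a b x \<Omega>]
    by (intro minimal_metric_le[of "\<lambda>z. x + Re z *\<^sub>R a + Im z *\<^sub>R b"]) (auto simp: a_def)
  then show ?thesis by simp
qed

lemma kobayashi_dist_segment_le:
  assumes R: "R > 0" and "\<And>p. p \<in> closed_segment a b \<Longrightarrow> ball p R \<subseteq> X"
  shows "kobayashi_dist X a b \<le> ennreal (norm (b - a) / R)"
  unfolding kobayashi_dist_def
proof (rule induced_dist_linepath_le)
  show "closed_segment a b \<subseteq> X" using assms by (meson centre_in_ball subsetD subsetI)
qed (use assms in \<open>auto intro: kobayashi_metric_ball_le\<close>)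

lemma minimal_dist_segment_le:
  fixes \<Omega> :: "(real ^ 'n) set"
  assumes n: "CARD('n) \<ge> 2" and R: "R > 0" and "\<And>p. p \<in> closed_segment a b \<Longrightarrow> ball p R \<subseteq> \<Omega>"
  shows "minimal_dist \<Omega> a b \<le> ennreal (norm (b - a) / R)"
  unfolding minimal_dist_def
proof (rule induced_dist_linepath_le)
  show "closed_segment a b \<subseteq> \<Omega>" using assms by (meson centre_in_ball subsetD subsetI)
qed (use assms in \<open>auto intro: minimal_metric_ball_le\<close>)

lemma segment_balls:
  fixes x :: "'a::real_normed_vector"
  assumes "ball x (2 * r) \<subseteq> X" "a \<in> ball x r" "b \<in> ball x r" "p \<in> closed_segment a b"
  shows "ball p r \<subseteq> X"
proof -
  have "p \<in> ball x r"
    using closed_segment_subset[OF assms(2,3) convex_ball] assms(4) by blast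
  then have "q \<in> ball x (2 * r)" if "q \<in> ball p r" for q
    using that dist_triangle[of x q p] by simp
  then show ?thesis using assms(1) by blast
qed

section \<open>Kobayashi hyperbolic domains\<close>

text \<open>With \<open>s = h / r\<close> the cost \<open>s / (1 - s)\<close> equals
  \<open>h / (r - h)\<close>, which is at most \<open>c * h\<close> as soon as
  \<open>h \<le> r - 1 / c\<close>. The strict inequality between \<open>1 / r\<close> and
  \<open>c\<close> makes this threshold positive.\<close>

lemma eventually_disc_increment_le:
  assumes "ennreal (1 / r) < ennreal c" "0 < r" "0 < c"
  shows "\<forall>\<^sub>F h in at_right 0. 0 < h / r \<and> h / r < 1 \<and> (h / r) / (1 - h / r) \<le> c * h"
proof -
  have rc: "1 / r < c" using assms by (simp add: ennreal_less_iff)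
  then have "0 < r - 1 / c" using assms by (simp add: field_simps)
  then have "\<forall>\<^sub>F h in at_right 0. h < r - 1 / c"
    by (intro order_tendstoD(2)[OF tendsto_ident_at])
  then show ?thesis
    using eventually_at_right_less[of "0::real"]
  proof eventually_elim
    case (elim h)
    then have hr: "h < r" using assms(3) by (smt (verit) divide_pos_pos)
    have "1 < c * (r - h)" using elim assms(3) by (simp add: field_simps)
    then have "h * 1 \<le> h * (c * (r - h))" using elim by (intro mult_left_mono) auto
    then have "h / (r - h) \<le> c * h" using hr by (simp add: pos_divide_le_eq mult_ac)
    moreover have "(h / r) / (1 - h / r) = h / (r - h)"
      using assms(2) hr by (simp add: field_simps)
    ultimately show ?case using elim hr assms(2) by simp
  qed
qed

locale kobayashi_hyperbolic_domain =
  fixes X :: "(complex ^ 'n) set"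
  assumes open_X: "open X"
    and hyperbolic: "kobayashi_hyperbolic X"
begin

definition d :: "complex ^ 'n \<Rightarrow> complex ^ 'n \<Rightarrow> real" where
  "d z w = enn2real (kobayashi_dist X z w)"

sublocale Metric_space X d
  using hyperbolic unfolding kobayashi_hyperbolic_def d_def .

lemma d_le: "kobayashi_dist X z w \<le> ennreal c \<Longrightarrow> 0 \<le> c \<Longrightarrow> d z w \<le> c"
  unfolding d_def by (rule enn2real_leI)

lemma d_segment_le:
  assumes "ball x (2 * r) \<subseteq> X" "r > 0" "a \<in> ball x r" "b \<in> ball x r"
  shows "d a b \<le> norm (b - a) / r"
  using assms by (intro d_le kobayashi_dist_segment_le segment_balls[OF assms(1)]) auto

lemma d_disc_le:
  assumes "f \<in> holomorphic_discs X" "0 < s" "s < 1"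
  shows "d (f 0) (f (of_real s)) \<le> s / (1 - s)"
  using assms by (intro d_le kobayashi_dist_disc_le) auto

lemma abs_diff_d_le:
  assumes "z \<in> X" "a \<in> X" "b \<in> X"
  shows "\<bar>d z a - d z b\<bar> \<le> d a b"
  using triangle[of z a b] triangle[of z b a] commute[of a b] assms by auto

lemma d_locally_lipschitz:
  assumes z: "z \<in> X" and x: "x \<in> X"
  obtains r C where "r > 0" "ball x r \<subseteq> X" "C-lipschitz_on (ball x r) (d z)"
proof -
  obtain R where R: "R > 0" "ball x R \<subseteq> X"
    using open_X x by (auto simp: open_contains_ball)
  define r where "r = R / 2"
  have r: "r > 0" "ball x (2 * r) \<subseteq> X" "ball x r \<subseteq> X"
    using R by (auto simp: r_def subset_ball intro: order_trans[OF subset_ball])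
  have "(1 / r)-lipschitz_on (ball x r) (d z)"
  proof (rule lipschitz_onI)
    fix a b assume ab: "a \<in> ball x r" "b \<in> ball x r"
    have "dist (d z a) (d z b) \<le> d a b"
      using abs_diff_d_le[OF z] ab r(3) unfolding dist_real_def by blast
    also have "\<dots> \<le> norm (b - a) / r" using d_segment_le r ab by blast
    finally show "dist (d z a) (d z b) \<le> 1 / r * dist a b"
      by (simp add: dist_norm norm_minus_commute)
  qed (use r in auto)
  then show ?thesis using r that by blast
qed

text \<open>The radius of a competing disc, reparametrised by \<open>h / r\<close>, starts with
  velocity \<open>v\<close>. Such curves are the \<open>\<sigma>\<close> required by
  \<open>increment_le_path_length\<close>.\<close>

lemma kobayashi_metric_curve:
  assumes "x \<in> X" "kobayashi_metric X x v < ennreal c" "0 < c"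
  obtains \<sigma> where "\<sigma> 0 = x" "(\<sigma> has_vector_derivative v) (at 0)"
    "\<forall>\<^sub>F h in at_right 0. \<sigma> h \<in> X \<and> d x (\<sigma> h) \<le> c * h"
proof -
  obtain f r where f: "f \<in> holomorphic_discs X" "f 0 = x" "r > 0"
    "(\<chi> i. deriv (\<lambda>z. f z $ i) 0) = r *\<^sub>R v" "ennreal (1 / r) < ennreal c"
    using kobayashi_metric_lessE[OF assms(2)] .
  define \<sigma> where "\<sigma> = (\<lambda>h. f (complex_of_real (h / r)))"
  have "(\<sigma> has_vector_derivative v) (at 0)"
    using holomorphic_disc_has_vector_derivative[OF f(1), of "1 / r" 0 0] f(3,4)
    by (simp add: \<sigma>_def)
  moreover have "\<sigma> 0 = x" by (simp add: \<sigma>_def f)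
  moreover have "\<forall>\<^sub>F h in at_right 0. \<sigma> h \<in> X \<and> d x (\<sigma> h) \<le> c * h"
    using eventually_disc_increment_le[OF f(5,3) assms(3)]
  proof eventually_elim
    case (elim h)
    then have "complex_of_real (h / r) \<in> ball 0 1"
      unfolding mem_ball_0 norm_of_real by linarith
    then have "\<sigma> h \<in> X" using f(1) by (auto simp: \<sigma>_def holomorphic_discs_def)
    moreover have "d x (\<sigma> h) \<le> c * h"
      using d_disc_le[OF f(1), of "h / r"] elim by (simp add: \<sigma>_def f(2))
    ultimately show ?case by blast
  qed
  ultimately show ?thesis using that by blast
qed

text \<open>The truncation \<open>u\<close> of the distance is constant outside the ball, so a path leaving the ball
  is controlled by \<open>increment_le_path_length\<close> without being cut at its exit point.\<close>

lemma d_lower_bound: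
  assumes z: "z \<in> X" and \<epsilon>: "\<epsilon> > 0"
  obtains \<delta> where "\<delta> > 0" "\<And>w. w \<in> X \<Longrightarrow> \<epsilon> \<le> dist z w \<Longrightarrow> \<delta> \<le> d z w"
proof -
  obtain R where R: "R > 0" "ball z R \<subseteq> X"
    using open_X z by (auto simp: open_contains_ball)
  \<comment> \<open>Halving \<open>R\<close> keeps the sphere inside \<open>X\<close>, where the
    distance from \<open>z\<close> is continuous.\<close>
  define e where "e = min \<epsilon> (R / 2)"
  have e: "e > 0" "e \<le> \<epsilon>" "sphere z e \<subseteq> X"
    using R \<epsilon> by (auto simp: e_def sphere_def)
  have "continuous_on (sphere z e) (d z)"
  proof (intro continuous_at_imp_continuous_on ballI)
    fix x assume "x \<in> sphere z e"
    then have "x \<in> X" using e by blast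
    then obtain r C where r: "r > 0" "ball x r \<subseteq> X" "C-lipschitz_on (ball x r) (d z)"
      by (rule d_locally_lipschitz[OF z])
    have "continuous_on (ball x r) (d z)" by (rule lipschitz_on_continuous_on[OF r(3)])
    then show "isCont (d z) x"
      using r(1) by (simp add: continuous_on_eq_continuous_at)
  qed
  \<comment> \<open>The factor 2 leaves a margin: close to the sphere the distance is still at least
    \<open>\<delta>\<close>, so the truncation is already constant there and has no jump.\<close>
  then obtain \<delta> where \<delta>: "\<delta> > 0" "\<And>x. x \<in> sphere z e \<Longrightarrow> 2 * \<delta> \<le> d z x"
  proof (cases "sphere z e = {}")
    case False
    assume "continuous_on (sphere z e) (d z)"
    then obtain m where m: "m \<in> sphere z e" "\<And>x. x \<in> sphere z e \<Longrightarrow> d z m \<le> d z x"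
      using continuous_attains_inf[OF compact_sphere False] by blast
    have "m \<noteq> z" "m \<in> X" using m(1) e by auto
    then have "d z m > 0" using z mdist_pos_eq by auto
    then show ?thesis using that[of "d z m / 2"] m by simp
  qed (use that[of 1] in auto)
  define u where "u = (\<lambda>w. if dist z w < e then min \<delta> (d z w) else \<delta>)"
  have u_le: "u w \<le> \<delta>" for w by (simp add: u_def)
  have lip: "\<exists>r>0. \<exists>C. C-lipschitz_on (ball x r \<inter> X) u" if x: "x \<in> X" for x
  proof -
    obtain r C where r: "r > 0" "ball x r \<subseteq> X" and C: "C-lipschitz_on (ball x r) (d z)"
      using d_locally_lipschitz[OF z x] .
    have C0: "C \<ge> 0" by (rule lipschitz_on_nonneg[OF C])
    have const: "\<exists>r>0. \<exists>C. C-lipschitz_on (ball x r \<inter> X) u"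
      if "s > 0" "\<And>w. w \<in> ball x s \<inter> X \<Longrightarrow> u w = \<delta>" for s
    proof -
      have "0-lipschitz_on (ball x s \<inter> X) u"
        using that(2) by (intro lipschitz_onI) auto
      then show ?thesis using that(1) by blast
    qed
    consider "dist z x < e" | "dist z x > e" | "dist z x = e" by linarith
    then show ?thesis
    proof cases
      case 1
      define s where "s = min r (e - dist z x)"
      have inball: "dist z w < e" if "w \<in> ball x s" for w
        using that dist_triangle[of z w x] by (auto simp: s_def)
      have "C-lipschitz_on (ball x s \<inter> X) u"
      proof (rule lipschitz_onI)
        fix a b assume ab: "a \<in> ball x s \<inter> X" "b \<in> ball x s \<inter> X"
        have "dist (u a) (u b) \<le> dist (d z a) (d z b)"
          using inball ab by (auto simp: u_def dist_real_def)
        also have "\<dots> \<le> C * dist a b"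
          using ab by (intro lipschitz_onD[OF C]) (auto simp: s_def)
        finally show "dist (u a) (u b) \<le> C * dist a b" .
      qed (rule C0)
      then show ?thesis using 1 r(1) by (intro exI[of _ s]) (auto simp: s_def)
    next
      case 2
      have "u w = \<delta>" if "w \<in> ball x (dist z x - e) \<inter> X" for w
        using that dist_triangle[of z x w] by (auto simp: u_def dist_commute)
      then show ?thesis using 2 by (intro const[of "dist z x - e"]) auto
    next
      case 3
      \<comment> \<open>Within this radius the distance from \<open>z\<close> falls by at most
        \<open>\<delta>\<close> from its value of at least \<open>2 * \<delta>\<close> on the
        sphere.\<close>
      define s where "s = min r (\<delta> / (C + 1))"
      have "u w = \<delta>" if w: "w \<in> ball x s \<inter> X" for w
      proof -
        have "\<bar>d z x - d z w\<bar> \<le> C * dist x w"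
          using lipschitz_onD[OF C, of x w] w r(1) by (auto simp: s_def dist_real_def)
        also have "\<dots> \<le> C * (\<delta> / (C + 1))"
          using w C0 by (intro mult_left_mono) (auto simp: s_def)
        also have "\<dots> \<le> \<delta>" using C0 \<delta>(1) by (simp add: pos_divide_le_eq algebra_simps)
        finally have "d z w \<ge> \<delta>" using \<delta>(2)[of x] 3 by simp
        then show ?thesis by (simp add: u_def)
      qed
      then show ?thesis using r(1) \<delta>(1) C0 by (intro const[of s]) (auto simp: s_def)
    qed
  qed
  have curve: "\<exists>\<sigma>. \<sigma> 0 = x \<and> (\<sigma> has_vector_derivative v) (at 0) \<and>
      (\<forall>\<^sub>F h in at_right 0. \<sigma> h \<in> X \<and> u (\<sigma> h) \<le> u x + c * h)"
    if x: "x \<in> X" and v: "kobayashi_metric X x v < ennreal c" and c: "0 < c" for x v c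
  proof -
    obtain \<sigma> where \<sigma>: "\<sigma> 0 = x" "(\<sigma> has_vector_derivative v) (at 0)"
      "\<forall>\<^sub>F h in at_right 0. \<sigma> h \<in> X \<and> d x (\<sigma> h) \<le> c * h"
      using kobayashi_metric_curve[OF x v c] .
    have "\<forall>\<^sub>F h in at_right 0. \<sigma> h \<in> X \<and> u (\<sigma> h) \<le> u x + c * h"
    proof (cases "dist z x < e")
      case True
      have "(\<sigma> \<longlongrightarrow> x) (at_right 0)"
        using has_vector_derivative_continuous[OF \<sigma>(2)] \<sigma>(1)
        by (auto simp: continuous_within intro: filterlim_mono[OF _ order_refl at_le])
      from tendstoD[OF this, of "e - dist z x"] True
      have near: "\<forall>\<^sub>F h in at_right 0. dist (\<sigma> h) x < e - dist z x" by simp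
      show ?thesis
        using \<sigma>(3) near
      proof eventually_elim
        case (elim h)
        then have "dist z (\<sigma> h) < e" using dist_triangle[of z "\<sigma> h" x] by (simp add: dist_commute)
        moreover have "d z (\<sigma> h) \<le> d z x + c * h"
          using triangle[OF z x, of "\<sigma> h"] elim by auto
        moreover have "0 \<le> c * h" using elim nonneg[of x "\<sigma> h"] by linarith
        ultimately show ?case using True elim by (auto simp: u_def min_def)
      qed
    next
      case False
      \<comment> \<open>Outside the ball \<open>u x\<close> already has its maximal value
        \<open>\<delta>\<close>, so \<open>u\<close> cannot increase along
        \<open>\<sigma>\<close>.\<close>
      show ?thesis
        using \<sigma>(3) eventually_at_right_less[of "0::real"]
        by eventually_elim (use False c u_le in \<open>auto simp: u_def intro: add_increasing2\<close>)
    qed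
    then show ?thesis using \<sigma> by blast
  qed
  have "\<delta> \<le> d z w" if w: "w \<in> X" "\<epsilon> \<le> dist z w" for w
  proof -
    have "ennreal \<delta> \<le> kobayashi_dist X z w"
      unfolding kobayashi_dist_def induced_dist_def
    proof (rule INF_greatest)
      fix \<gamma> assume \<gamma>: "\<gamma> \<in> {\<gamma>. piecewise_smooth_path \<gamma> \<and> path_image \<gamma> \<subseteq> X \<and> pathstart \<gamma> = z \<and> pathfinish \<gamma> = w}"
      then have "ennreal (u (pathfinish \<gamma>) - u (pathstart \<gamma>)) \<le> path_length_wrt (kobayashi_metric X) \<gamma>"
        using increment_le_path_length[OF _ _ lip curve, of \<gamma>] by simp
      moreover have "u z = 0" "u w = \<delta>"
        using z w e \<delta>(1) by (auto simp: u_def)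
      ultimately show "ennreal \<delta> \<le> path_length_wrt (kobayashi_metric X) \<gamma>"
        using \<gamma> by simp
    qed
    \<comment> \<open>An infinite Kobayashi distance would give \<open>d z w = 0\<close>; positivity
      for distinct points therefore forces finiteness.\<close>
    moreover have "z \<noteq> w" using w \<epsilon> by auto
    then have "d z w > 0" using z w mdist_pos_eq by auto
    then have "kobayashi_dist X z w < top" by (simp add: d_def enn2real_positive_iff)
    ultimately show ?thesis
      unfolding d_def using \<delta>(1) by (metis enn2real_ennreal enn2real_mono less_eq_real_def)
  qed
  then show ?thesis using \<delta>(1) that by blast
qed

end

text \<open>An imaginary translation preserves real parts and the tube, so the lift can start at any
  prescribed point of the fibre. Every competitor in an infimum over a fibre can thus be moved along
  the disc.\<close>

lemma CH_lift_disc: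
  assumes f: "f \<in> CH \<Omega>"
  obtains F where "F \<in> holomorphic_discs (tube \<Omega>)" "F 0 = cvec (f 0) \<eta>"
    "\<And>z. z \<in> ball 0 1 \<Longrightarrow> re_vec (F z) = f z"
proof -
  obtain G where G: "\<And>i. (\<lambda>z. G z $ i) holomorphic_on ball 0 1"
    "\<And>z i. z \<in> ball 0 1 \<Longrightarrow> Re (G z $ i) = f z $ i"
    using CH_holomorphic_lift[OF f] by metis
  define F where "F = (\<lambda>z. \<chi> i. G z $ i + \<i> * complex_of_real (\<eta> $ i - Im (G 0 $ i)))"
  have re: "re_vec (F z) = f z" if "z \<in> ball 0 1" for z
    using G(2)[OF that] by (simp add: F_def re_vec_def vec_eq_iff)
  have "(\<lambda>z. F z $ i) holomorphic_on ball 0 1" for i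
    using G(1)[of i] unfolding F_def vec_lambda_beta by (intro holomorphic_intros)
  moreover have "F z \<in> tube \<Omega>" if "z \<in> ball 0 1" for z
    using re[OF that] CH_D(10)[OF f] that by (auto simp: tube_iff)
  ultimately have "F \<in> holomorphic_discs (tube \<Omega>)"
    by (auto simp: holomorphic_discs_def)
  moreover have "F 0 = cvec (f 0) \<eta>"
    using G(2)[of 0] by (simp add: F_def cvec_def vec_eq_iff complex_eq_iff)
  ultimately show ?thesis using re that by blast
qed

section \<open>Comparison of the minimal and the Kobayashi distance\<close>

context kobayashi_hyperbolic_domain
begin

text \<open>The infimum over the fibre need not be attained; working with a strict bound
  \<open>c\<close> still yields an actual end point \<open>w\<close>, from which a further lift can
  start.\<close>

lemma minimal_dist_lift:
  assumes X: "X = tube \<Omega>" and \<Omega>: "open \<Omega>" and z: "z \<in> X"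
    and less: "minimal_dist \<Omega> (re_vec z) y < ennreal c"
  obtains w where "w \<in> X" "re_vec w = y" "d z w < c"
proof -
  obtain \<gamma> where \<gamma>: "piecewise_smooth_path \<gamma>" "path_image \<gamma> \<subseteq> \<Omega>" "pathstart \<gamma> = re_vec z" "pathfinish \<gamma> = y"
    and len: "path_length_wrt (minimal_metric \<Omega>) \<gamma> < ennreal c"
    using less unfolding minimal_dist_def by (rule induced_dist_lessE)
  define u where "u = (\<lambda>x. INF \<eta>. d z (cvec x \<eta>))"
  have bdd: "bdd_below (range (\<lambda>\<eta>. d z (cvec x \<eta>)))" for x
    by (rule bdd_belowI2[of _ 0]) simp
  have u_le: "u x \<le> d z (cvec x \<eta>)" for x \<eta>
    unfolding u_def by (rule cINF_lower[OF bdd]) simp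
  have u_ge: "a \<le> u x + b" if "\<And>\<eta>. a \<le> d z (cvec x \<eta>) + b" for a b x
  proof -
    have "a - b \<le> u x"
      unfolding u_def using that by (intro cINF_greatest) (auto simp: diff_le_eq)
    then show ?thesis by simp
  qed
  have lip: "\<exists>r>0. \<exists>C. C-lipschitz_on (ball x r \<inter> \<Omega>) u" if x: "x \<in> \<Omega>" for x
  proof -
    obtain R where R: "R > 0" "ball x R \<subseteq> \<Omega>"
      using \<Omega> x by (auto simp: open_contains_ball)
    define r where "r = R / 2"
    have r: "r > 0" "ball x (2 * r) \<subseteq> \<Omega>" using R by (auto simp: r_def)
    \<comment> \<open>The tube is invariant under imaginary translations, so the same radius
      \<open>r\<close> works at every height \<open>\<eta>\<close>. The Lipschitz estimate is
      therefore uniform in \<open>\<eta>\<close> and survives the infimum.\<close>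
    have tri: "u b \<le> u a + norm (b - a) / r" if ab: "a \<in> ball x r" "b \<in> ball x r" for a b
    proof (rule u_ge)
      fix \<eta>
      have ball: "ball (cvec x \<eta>) (2 * r) \<subseteq> X"
      proof
        fix w assume "w \<in> ball (cvec x \<eta>) (2 * r)"
        then have "re_vec w \<in> ball x (2 * r)"
          using norm_re_vec_diff_le[of "cvec x \<eta>" w] by (simp add: dist_norm)
        then show "w \<in> X" using r(2) by (auto simp: X tube_iff)
      qed
      have mem: "cvec a \<eta> \<in> ball (cvec x \<eta>) r" "cvec b \<eta> \<in> ball (cvec x \<eta>) r"
        using ab by (simp_all add: dist_norm norm_cvec_diff)
      moreover from this ball have "cvec a \<eta> \<in> X" "cvec b \<eta> \<in> X"
        using subset_ball[of r "2 * r" "cvec x \<eta>"] r(1) by auto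
      ultimately have "d z (cvec b \<eta>) \<le> d z (cvec a \<eta>) + norm (b - a) / r"
        using triangle[OF z, of "cvec a \<eta>" "cvec b \<eta>"] d_segment_le[OF ball r(1) mem]
        by (simp add: norm_cvec_diff)
      then show "u b \<le> d z (cvec a \<eta>) + norm (b - a) / r"
        using u_le[of b \<eta>] by linarith
    qed
    have "(1 / r)-lipschitz_on (ball x r \<inter> \<Omega>) u"
    proof (rule lipschitz_onI)
      fix a b assume "a \<in> ball x r \<inter> \<Omega>" "b \<in> ball x r \<inter> \<Omega>"
      then show "dist (u a) (u b) \<le> 1 / r * dist a b"
        using tri[of a b] tri[of b a] by (auto simp: dist_real_def dist_norm norm_minus_commute)
    qed (use r in auto)
    then show ?thesis using r(1) by blast
  qed
  have curve: "\<exists>\<sigma>. \<sigma> 0 = x \<and> (\<sigma> has_vector_derivative v) (at 0) \<and>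
      (\<forall>\<^sub>F h in at_right 0. \<sigma> h \<in> \<Omega> \<and> u (\<sigma> h) \<le> u x + b * h)"
    if "x \<in> \<Omega>" and v: "minimal_metric \<Omega> x v < ennreal b" and b: "0 < b" for x v b
  proof -
    obtain f r where f: "f \<in> CH \<Omega>" "f 0 = x" "r > 0" "partial_x f 0 = r *\<^sub>R v" "ennreal (1 / r) < ennreal b"
      using minimal_metric_lessE[OF v] .
    define \<sigma> where "\<sigma> = (\<lambda>h. f (complex_of_real (h / r)))"
    have "(\<sigma> has_vector_derivative v) (at 0)"
    proof -
      have 1: "((\<lambda>h. complex_of_real (h / r)) has_vector_derivative complex_of_real (1 / r)) (at 0)"
        using f(3) by (auto intro!: derivative_eq_intros)
      have 2: "(f has_derivative (\<lambda>h. Re h *\<^sub>R partial_x f 0 + Im h *\<^sub>R partial_y f 0))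
          (at (complex_of_real (0 / r)))"
        using CH_D(1)[OF f(1), of 0] by simp
      from vector_derivative_diff_chain_within[OF 1 has_derivative_at_withinI[OF 2]] show ?thesis
        using f(3) by (simp add: \<sigma>_def o_def f(4) del: of_real_divide)
    qed
    moreover have "\<sigma> 0 = x" by (simp add: \<sigma>_def f)
    moreover have "\<forall>\<^sub>F h in at_right 0. \<sigma> h \<in> \<Omega> \<and> u (\<sigma> h) \<le> u x + b * h"
      using eventually_disc_increment_le[OF f(5,3) b]
    proof eventually_elim
      case (elim h)
      then have ball: "complex_of_real (h / r) \<in> ball 0 1"
        unfolding mem_ball_0 norm_of_real by linarith
      then have "\<sigma> h \<in> \<Omega>" using CH_D(10)[OF f(1)] by (auto simp: \<sigma>_def)
      moreover have "u (\<sigma> h) \<le> u x + b * h"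
      \<comment> \<open>For each \<open>\<eta>\<close> the disc is lifted through
        \<open>cvec x \<eta>\<close>. Its point at \<open>h / r\<close> lies in the fibre over
        \<open>\<sigma> h\<close>, at whatever height, and so bounds
        \<open>u (\<sigma> h)\<close>.\<close>
      proof (rule u_ge)
        fix \<eta>
        obtain F where F: "F \<in> holomorphic_discs X" "F 0 = cvec x \<eta>"
          "re_vec (F (of_real (h / r))) = \<sigma> h"
          using CH_lift_disc[OF f(1), of \<eta>] f(2) ball unfolding X \<sigma>_def by metis
        define w where "w = F (of_real (h / r))"
        have wX: "w \<in> X" "cvec x \<eta> \<in> X"
          using F(1) ball by (auto simp: w_def holomorphic_discs_def simp flip: F(2))
        have "d (cvec x \<eta>) w \<le> b * h"
          using d_disc_le[OF F(1), of "h / r"] elim by (simp add: F(2) w_def)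
        then have "d z w \<le> d z (cvec x \<eta>) + b * h"
          using triangle[OF z wX(2,1)] by simp
        moreover have "w = cvec (\<sigma> h) (\<chi> i. Im (w $ i))"
          using cvec_re_vec[of w] F(3) by (simp add: w_def)
        ultimately show "u (\<sigma> h) \<le> d z (cvec x \<eta>) + b * h"
          using u_le[of "\<sigma> h"] by (metis order_trans)
      qed
      ultimately show ?case by blast
    qed
    ultimately show ?thesis by blast
  qed
  have "ennreal (u y - u (re_vec z)) \<le> path_length_wrt (minimal_metric \<Omega>) \<gamma>"
    using increment_le_path_length[OF \<gamma>(1,2) lip curve] \<gamma>(3,4) by simp
  then have "ennreal (u y - u (re_vec z)) < ennreal c"
    using len by (rule order_le_less_trans)
  then have "u y - u (re_vec z) < c"
    using ennreal_leI[of c "u y - u (re_vec z)"] by (meson leD leI)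
  \<comment> \<open>The point \<open>z\<close> itself belongs to the fibre over its real
    part.\<close>
  moreover have "u (re_vec z) \<le> 0"
    using u_le[of "re_vec z" "\<chi> i. Im (z $ i)"] z by (simp add: cvec_re_vec)
  ultimately have "u y < c" by simp
  then obtain \<eta> where "d z (cvec y \<eta>) < c"
    unfolding u_def using cINF_less_iff[OF _ bdd] by auto
  moreover have "y \<in> \<Omega>" using \<gamma>(2,4) pathfinish_in_path_image by blast
  then have "cvec y \<eta> \<in> X" by (simp add: X tube_iff)
  ultimately show ?thesis using that by simp
qed

text \<open>Taking real parts does not increase Euclidean distances, so the whole fibre over
  \<open>y\<close> stays at distance at least \<open>dist x y\<close> from \<open>z\<close>. A
  single \<open>\<delta>\<close> therefore serves all lifts of \<open>y\<close>.\<close>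

lemma hyperbolic_domain_if_tube:
  assumes X: "X = tube \<Omega>" and \<Omega>: "open \<Omega>"
  shows "hyperbolic_domain \<Omega>"
  unfolding hyperbolic_domain_def
proof (intro ballI impI)
  fix x y assume xy: "x \<in> \<Omega>" "y \<in> \<Omega>" "x \<noteq> y"
  define z where "z = cvec x 0"
  have z: "z \<in> X" "re_vec z = x" using xy by (auto simp: z_def X tube_iff)
  obtain \<delta> where \<delta>: "\<delta> > 0" "\<And>w. w \<in> X \<Longrightarrow> dist x y \<le> dist z w \<Longrightarrow> \<delta> \<le> d z w"
    using d_lower_bound[OF z(1), of "dist x y"] xy by auto
  show "minimal_dist \<Omega> x y > 0"
  proof (rule ccontr)
    assume "\<not> minimal_dist \<Omega> x y > 0"
    then have "minimal_dist \<Omega> (re_vec z) y < ennreal \<delta>" using z(2) \<delta>(1) by simp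
    then obtain w where w: "w \<in> X" "re_vec w = y" "d z w < \<delta>"
      by (rule minimal_dist_lift[OF X \<Omega> z(1)])
    have "dist x y \<le> dist z w"
      using norm_re_vec_diff_le[of z w] z(2) w(2) by (simp add: dist_norm)
    then show False using \<delta>(2)[OF w(1)] w(3) by simp
  qed
qed

end

section \<open>The minimal distance\<close>

lemma minimal_dist_local_le:
  fixes \<Omega> :: "(real ^ 'n) set"
  assumes n: "CARD('n) \<ge> 2" and "open \<Omega>" "x \<in> \<Omega>"
  obtains r where "r > 0" "ball x r \<subseteq> \<Omega>"
    "\<And>a b. \<lbrakk>a \<in> ball x r; b \<in> ball x r\<rbrakk> \<Longrightarrow> minimal_dist \<Omega> a b \<le> ennreal (norm (b - a) / r)"
proof -
  obtain R where R: "R > 0" "ball x R \<subseteq> \<Omega>"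
    using assms by (auto simp: open_contains_ball)
  define r where "r = R / 2"
  have r: "r > 0" "ball x (2 * r) \<subseteq> \<Omega>" "ball x r \<subseteq> \<Omega>"
    using R by (auto simp: r_def intro: order_trans[OF subset_ball])
  then show ?thesis
    using that minimal_dist_segment_le[OF n r(1)] segment_balls[OF r(2)] by blast
qed

lemma minimal_dist_self:
  fixes \<Omega> :: "(real ^ 'n) set"
  assumes "CARD('n) \<ge> 2" "open \<Omega>" "x \<in> \<Omega>"
  shows "minimal_dist \<Omega> x x = 0"
proof -
  obtain r where "r > 0" "\<And>a b. \<lbrakk>a \<in> ball x r; b \<in> ball x r\<rbrakk> \<Longrightarrow> minimal_dist \<Omega> a b \<le> ennreal (norm (b - a) / r)"
    using minimal_dist_local_le[OF assms] by metis
  from this(2)[of x x] this(1) show ?thesis by simp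
qed

lemma minimal_dist_sym: "minimal_dist \<Omega> x y = minimal_dist \<Omega> y x"
  unfolding minimal_dist_def by (rule induced_dist_sym) (rule minimal_metric_uminus_le)

lemma minimal_dist_triangle: "minimal_dist \<Omega> x z \<le> minimal_dist \<Omega> x y + minimal_dist \<Omega> y z"
  unfolding minimal_dist_def by (rule induced_dist_triangle) (rule minimal_metric_double_le)

text \<open>Finiteness of the distance from \<open>x\<close> spreads over small balls by the local
  bound and the triangle inequality, hence over the connected set. Without it
  \<open>enn2real\<close> could identify distinct points.\<close>

lemma minimal_dist_finite:
  fixes \<Omega> :: "(real ^ 'n) set"
  assumes n: "CARD('n) \<ge> 2" and \<Omega>: "open \<Omega>" "connected \<Omega>" and xy: "x \<in> \<Omega>" "y \<in> \<Omega>"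
  shows "minimal_dist \<Omega> x y < top"
proof (rule connected_induction_simple[OF \<Omega>(2) xy, where P = "\<lambda>y. minimal_dist \<Omega> x y < top"])
  show "minimal_dist \<Omega> x x < top"
    using minimal_dist_self[OF n \<Omega>(1) xy(1)] by simp
  fix p assume "p \<in> \<Omega>"
  then obtain r where r: "r > 0" "ball p r \<subseteq> \<Omega>"
    "\<And>a b. \<lbrakk>a \<in> ball p r; b \<in> ball p r\<rbrakk> \<Longrightarrow> minimal_dist \<Omega> a b \<le> ennreal (norm (b - a) / r)"
    using minimal_dist_local_le[OF n \<Omega>(1)] by metis
  have "minimal_dist \<Omega> x b < top"
    if "a \<in> ball p r" "b \<in> ball p r" "minimal_dist \<Omega> x a < top" for a b
  proof -
    have "minimal_dist \<Omega> x b \<le> minimal_dist \<Omega> x a + minimal_dist \<Omega> a b"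
      by (rule minimal_dist_triangle)
    also have "\<dots> < top"
      using that(3) order_le_less_trans[OF r(3)[OF that(1,2)] ennreal_less_top] by simp
    finally show ?thesis .
  qed
  moreover have "openin (top_of_set \<Omega>) (ball p r)"
    using r(2) by (simp add: open_subset)
  ultimately show "\<exists>T. openin (top_of_set \<Omega>) T \<and> p \<in> T \<and>
      (\<forall>a\<in>T. \<forall>b\<in>T. minimal_dist \<Omega> x a < top \<longrightarrow> minimal_dist \<Omega> x b < top)"
    using centre_in_ball[of p r] r(1) by blast
qed

lemma Metric_space_minimal_dist:
  fixes \<Omega> :: "(real ^ 'n) set"
  assumes n: "CARD('n) \<ge> 2" and \<Omega>: "open \<Omega>" "connected \<Omega>" and hyp: "hyperbolic_domain \<Omega>"
  shows "Metric_space \<Omega> (\<lambda>x y. enn2real (minimal_dist \<Omega> x y))"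
proof
  fix x y z
  show "0 \<le> enn2real (minimal_dist \<Omega> x y)" by simp
  show "enn2real (minimal_dist \<Omega> x y) = enn2real (minimal_dist \<Omega> y x)"
    by (simp add: minimal_dist_sym[of \<Omega> x y])
  assume x: "x \<in> \<Omega>" and y: "y \<in> \<Omega>"
  note fin = minimal_dist_finite[OF n \<Omega>]
  show "enn2real (minimal_dist \<Omega> x y) = 0 \<longleftrightarrow> x = y"
  proof
    assume 0: "enn2real (minimal_dist \<Omega> x y) = 0"
    show "x = y"
    proof (rule ccontr)
      assume "x \<noteq> y"
      then have "0 < minimal_dist \<Omega> x y" using hyp x y by (simp add: hyperbolic_domain_def)
      then have "0 < enn2real (minimal_dist \<Omega> x y)"
        using fin[OF x y] by (simp add: enn2real_positive_iff)
      then show False using 0 by simp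
    qed
  qed (use minimal_dist_self[OF n \<Omega>(1) x] in simp)
  assume z: "z \<in> \<Omega>"
  have "enn2real (minimal_dist \<Omega> x z) \<le> enn2real (minimal_dist \<Omega> x y + minimal_dist \<Omega> y z)"
    by (rule enn2real_mono[OF minimal_dist_triangle]) (use fin x y z in simp)
  also have "\<dots> = enn2real (minimal_dist \<Omega> x y) + enn2real (minimal_dist \<Omega> y z)"
    using fin x y z by (intro enn2real_plus) auto
  finally show "enn2real (minimal_dist \<Omega> x z) \<le> \<dots>" .
qed

section \<open>Sequences with summable steps\<close>

context Metric_space
begin

lemma MCauchy_geometric:
  assumes X: "\<And>k. z k \<in> M" and step: "\<And>k. d (z k) (z (Suc k)) < (1 / 2) ^ k"
  shows "MCauchy z"
  unfolding MCauchy_def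
proof (intro conjI allI impI)
  show "range z \<subseteq> M" using X by auto
  have bound: "d (z m) (z (m + j)) \<le> 2 * (1 / 2) ^ m" for m j
  proof -
    have "d (z m) (z (m + j)) \<le> 2 * (1 / 2) ^ m - 2 * (1 / 2) ^ (m + j)"
    proof (induction j)
      case (Suc j)
      then show ?case
        using triangle[OF X[of m] X[of "m + j"] X[of "m + Suc j"]] step[of "m + j"] by simp
    qed (simp add: X)
    also have "\<dots> \<le> 2 * (1 / 2) ^ m" by simp
    finally show ?thesis .
  qed
  fix e :: real assume "0 < e"
  then obtain N where N: "(1 / 2) ^ N < e / 2"
    using real_arch_pow_inv[of "e / 2" "1 / 2"] by auto
  have "d (z m) (z n) < e" if "N \<le> m" "m \<le> n" for m n
  proof -
    have "d (z m) (z n) \<le> 2 * (1 / 2) ^ m" using bound[of m "n - m"] that by simp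
    also have "\<dots> \<le> 2 * (1 / 2) ^ N" using that by (intro mult_left_mono power_decreasing) auto
    also have "\<dots> < e" using N by simp
    finally show ?thesis .
  qed
  then show "\<exists>N. \<forall>m n. N \<le> m \<longrightarrow> N \<le> n \<longrightarrow> d (z m) (z n) < e"
    by (metis commute nle_le)
qed

text \<open>Lifting controls only the step from one chosen point to the next, not all pairs at once.
  Summable consecutive steps are what makes the lifted sequence Cauchy.\<close>

lemma MCauchy_geometric_subsequence:
  assumes "MCauchy \<sigma>"
  obtains r where "strict_mono r" "\<And>k. d (\<sigma> (r k)) (\<sigma> (r (Suc k))) < (1 / 2) ^ k"
proof -
  have "\<exists>N. \<forall>n n'. N \<le> n \<longrightarrow> N \<le> n' \<longrightarrow> d (\<sigma> n) (\<sigma> n') < (1 / 2) ^ k" for k :: nat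
    using assms unfolding MCauchy_def by simp
  then obtain N where N: "\<And>k n n'. N k \<le> n \<Longrightarrow> N k \<le> n' \<Longrightarrow> d (\<sigma> n) (\<sigma> n') < (1 / 2) ^ k"
    by metis
  have "\<exists>r :: nat \<Rightarrow> nat. \<forall>k. N k \<le> r k \<and> r k < r (Suc k)"
  proof (rule dependent_nat_choice)
    show "\<exists>m. N 0 \<le> m" by blast
    show "\<exists>m'. N (Suc k) \<le> m' \<and> m < m'" for m k
      by (rule exI[of _ "max (N (Suc k)) (Suc m)"]) auto
  qed
  then obtain r where r: "\<And>k. N k \<le> r k" "\<And>k. r k < r (Suc k)" by blast
  have "d (\<sigma> (r k)) (\<sigma> (r (Suc k))) < (1 / 2) ^ k" for k
    using N[OF r(1)[of k], of "r (Suc k)"] r(1)[of k] r(2)[of k] by simp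
  moreover have "strict_mono r" using r(2) by (simp add: strict_mono_Suc_iff)
  ultimately show ?thesis by (rule that[rotated])
qed

end

context kobayashi_hyperbolic_domain
begin

lemma complete_hyperbolic_domain_if_tube:
  assumes n: "CARD('n) \<ge> 2" and X: "X = tube \<Omega>" and \<Omega>: "open \<Omega>" "connected \<Omega>" and complete: "mcomplete"
  shows "complete_hyperbolic_domain \<Omega>"
proof -
  let ?\<rho> = "\<lambda>x y. enn2real (minimal_dist \<Omega> x y)"
  have hyp: "hyperbolic_domain \<Omega>" by (rule hyperbolic_domain_if_tube[OF X \<Omega>(1)])
  have metric: "Metric_space \<Omega> ?\<rho>"
    by (rule Metric_space_minimal_dist[OF n \<Omega> hyp])
  interpret \<rho>: Metric_space \<Omega> ?\<rho> by (rule metric)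
  have "\<rho>.mcomplete"
    unfolding \<rho>.mcomplete_def
  proof (intro allI impI)
    fix \<sigma> assume cauchy: "\<rho>.MCauchy \<sigma>"
    then have \<sigma>\<Omega>: "\<sigma> k \<in> \<Omega>" for k by (auto simp: \<rho>.MCauchy_def)
    obtain r where r: "strict_mono r"
      and step: "\<And>k. ?\<rho> (\<sigma> (r k)) (\<sigma> (r (Suc k))) < (1 / 2) ^ k"
      using \<rho>.MCauchy_geometric_subsequence[OF cauchy] by metis
    \<comment> \<open>The lifts are chosen successively: the point over the next term is found
      relative to the one already chosen, since its height in the fibre depends on it.\<close>
    have "\<exists>z. \<forall>k. (z k \<in> X \<and> re_vec (z k) = \<sigma> (r k)) \<and> d (z k) (z (Suc k)) < (1 / 2) ^ k"
    proof (rule dependent_nat_choice)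
      show "\<exists>z. z \<in> X \<and> re_vec z = \<sigma> (r 0)"
        using \<sigma>\<Omega> by (intro exI[of _ "cvec (\<sigma> (r 0)) 0"]) (simp add: X tube_iff)
      fix z k assume z: "z \<in> X \<and> re_vec z = \<sigma> (r k)"
      \<comment> \<open>Finiteness is what allows the bound on the real distance to be carried back
        to \<open>minimal_dist\<close>.\<close>
      have "minimal_dist \<Omega> (\<sigma> (r k)) (\<sigma> (r (Suc k))) = ennreal (?\<rho> (\<sigma> (r k)) (\<sigma> (r (Suc k))))"
        using minimal_dist_finite[OF n \<Omega> \<sigma>\<Omega> \<sigma>\<Omega>] by (simp add: less_top)
      also have "\<dots> < ennreal ((1 / 2) ^ k)"
        using step[of k] by (intro ennreal_lessI) auto
      finally have "minimal_dist \<Omega> (re_vec z) (\<sigma> (r (Suc k))) < ennreal ((1 / 2) ^ k)"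
        using z by simp
      from minimal_dist_lift[OF X \<Omega>(1) conjunct1[OF z] this]
      show "\<exists>w. (w \<in> X \<and> re_vec w = \<sigma> (r (Suc k))) \<and> d z w < (1 / 2) ^ k"
        by blast
    qed
    then obtain z where z: "\<And>k. z k \<in> X" "\<And>k. re_vec (z k) = \<sigma> (r k)"
      "\<And>k. d (z k) (z (Suc k)) < (1 / 2) ^ k" by blast
    have "MCauchy z" using z(1,3) by (rule MCauchy_geometric)
    then obtain w where w: "limitin mtopology z w sequentially"
      using complete unfolding mcomplete_def by blast
    then have wX: "w \<in> X" and wlim: "\<And>e. e > 0 \<Longrightarrow> \<forall>\<^sub>F k in sequentially. d (z k) w < e"
      by (auto simp: limitin_metric elim: eventually_mono)
    define x where "x = re_vec w"
    have x: "x \<in> \<Omega>" using wX by (simp add: x_def X tube_iff)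
    obtain s where s: "s > 0" "ball x s \<subseteq> \<Omega>"
      "\<And>a b. \<lbrakk>a \<in> ball x s; b \<in> ball x s\<rbrakk> \<Longrightarrow> minimal_dist \<Omega> a b \<le> ennreal (norm (b - a) / s)"
      using minimal_dist_local_le[OF n \<Omega>(1) x] by metis
    have "limitin \<rho>.mtopology (\<sigma> \<circ> r) x sequentially"
      unfolding \<rho>.limitin_metric
    proof (intro conjI allI impI)
      fix e :: real assume e: "0 < e"
      \<comment> \<open>The bound \<open>s\<close> keeps the points in the ball where the local
        estimate holds, and \<open>s * e\<close> makes that estimate smaller than
        \<open>e\<close>.\<close>
      define e' where "e' = min s (s * e)"
      have e': "e' > 0" using s(1) e by (simp add: e'_def)
      \<comment> \<open>Applied at the limit \<open>w\<close>, the lower bound shows that the lifts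
        also converge to \<open>w\<close> in the Euclidean sense.\<close>
      obtain \<delta> where \<delta>: "\<delta> > 0" "\<And>v. v \<in> X \<Longrightarrow> e' \<le> dist w v \<Longrightarrow> \<delta> \<le> d w v"
        using d_lower_bound[OF wX e'] by metis
      show "\<forall>\<^sub>F k in sequentially. (\<sigma> \<circ> r) k \<in> \<Omega> \<and> ?\<rho> ((\<sigma> \<circ> r) k) x < e"
        using wlim[OF \<delta>(1)]
      proof eventually_elim
        case (elim k)
        then have "dist w (z k) < e'" using \<delta>(2)[OF z(1)[of k]] commute[of w "z k"] by linarith
        then have near: "norm (x - \<sigma> (r k)) < e'"
          using norm_re_vec_diff_le[of w "z k"] by (simp add: x_def z(2) dist_norm)
        then have "\<sigma> (r k) \<in> ball x s" by (simp add: e'_def dist_norm)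
        then have "minimal_dist \<Omega> (\<sigma> (r k)) x \<le> ennreal (norm (x - \<sigma> (r k)) / s)"
          using s by simp
        then have "?\<rho> (\<sigma> (r k)) x \<le> norm (x - \<sigma> (r k)) / s"
          using s(1) by (intro enn2real_leI) auto
        also have "\<dots> < e" using near s(1) by (simp add: e'_def pos_divide_less_eq mult.commute)
        finally show ?case using \<sigma>\<Omega> by simp
      qed
    qed (rule x)
    then show "\<exists>x. limitin \<rho>.mtopology \<sigma> x sequentially"
      using \<rho>.MCauchy_convergent_subsequence[OF cauchy r] by blast
  qed
  then show ?thesis
    unfolding complete_hyperbolic_domain_def using hyp metric by blast
qed

end

theorem theorem6p1:
  fixes \<Omega> :: "(real ^ 'n) set"
  assumes "CARD('n) \<ge> 3"
    and "open \<Omega>" and "connected \<Omega>" and "\<Omega> \<noteq> {}"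
  shows "(kobayashi_hyperbolic (tube \<Omega>) \<longrightarrow> hyperbolic_domain \<Omega>) \<and>
         (kobayashi_complete_hyperbolic (tube \<Omega>) \<longrightarrow> complete_hyperbolic_domain \<Omega>)"
proof (intro conjI impI)
  have loc: "kobayashi_hyperbolic_domain (tube \<Omega>)" if "kobayashi_hyperbolic (tube \<Omega>)"
    using that open_tube[OF assms(2)] by unfold_locales
  show "hyperbolic_domain \<Omega>" if "kobayashi_hyperbolic (tube \<Omega>)"
    using kobayashi_hyperbolic_domain.hyperbolic_domain_if_tube[OF loc[OF that] refl assms(2)] .
  assume complete: "kobayashi_complete_hyperbolic (tube \<Omega>)"
  then interpret kobayashi_hyperbolic_domain "tube \<Omega>"
    by (intro loc) (simp add: kobayashi_complete_hyperbolic_def kobayashi_hyperbolic_def)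
  have "mcomplete"
    using complete unfolding kobayashi_complete_hyperbolic_def d_def[abs_def] by blast
  then show "complete_hyperbolic_domain \<Omega>"
    using complete_hyperbolic_domain_if_tube[OF _ refl] assms by simp
qed

end
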